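(* Let $G$ be a noncyclic abelian group of order less than $200$. Then $G$ has no nontrivial near-factorization.
   Context: Let $G$ be a finite multiplicative group with identity $e$. For $A, B \subseteq G$, let $AB = \{gh : g \in A, h \in B\}$. The pair $(A,B)$ is a near-factorization of $G$ if $|A| \cdot |B| = |G| - 1$ and $AB = G \setminus \{e\}$. A near-factorization $(A,B)$ is nontrivial if $|A| > 1$ and $|B| > 1$. *)

theory Defs
  imports "HOL-Algebra.Algebra"
begin

text \<open>Both notions are meant for finite groups only: for infinite \<open>G\<close>, \<open>order G\<close> is \<open>0\<close>.\<close>

definition near_factorization ::
    "('a, 'b) monoid_scheme \<Rightarrow> 'a set \<Rightarrow> 'a set \<Rightarrow> bool" where
  "near_factorization G A B \<longleftrightarrow>
     A \<subseteq> carrier G \<and> B \<subseteq> carrier G \<and>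
     card A * card B = order G - 1 \<and>
     A <#>\<^bsub>G\<^esub> B = carrier G - {\<one>\<^bsub>G\<^esub>}"

definition nontrivial_near_factorization ::
    "('a, 'b) monoid_scheme \<Rightarrow> 'a set \<Rightarrow> 'a set \<Rightarrow> bool" where
  "nontrivial_near_factorization G A B \<longleftrightarrow>
     near_factorization G A B \<and> card A > 1 \<and> card B > 1"

end

theory Submission
  imports Defs "HOL-Number_Theory.Residues" Complex_Main
begin

hide_const (open) Divisibility.prime

text \<open>If \<open>AB = G - {1}\<close> with unique factorizations, then \<open>\<chi>(A) \<chi>(B) = -1\<close> for every nontrivial
  character \<open>\<chi>\<close>, where \<open>\<chi>(X)\<close> is the sum of \<open>\<chi>\<close> over \<open>X\<close>. So \<open>\<chi>(A)\<close> is a unit, and for \<open>\<chi>\<close> of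
  odd prime order \<open>p\<close> its norm is \<open>1\<close>. A noncyclic \<open>G\<close> has, for some \<open>p\<close>, two independent characters
  of order \<open>p\<close>; summing the norms over the \<open>p\<^sup>2\<close> characters that they generate gives
  \<open>|A|\<^bsup>p-1\<^esup> = 1\<close> modulo \<open>p\<^sup>2\<close>. Together with \<open>|A| |B| + 1 = |G| < 200\<close> this leaves, for \<open>p > 3\<close>, only
  \<open>|G| = 121\<close> with \<open>{|A|, |B|} = {3, 40}\<close> and \<open>|G| = 50\<close> with \<open>|A| = |B| = 7\<close>.

  For \<open>p \<le> 3\<close> let \<open>N\<close> be the common kernel of the two characters. Up to exchanging \<open>A\<close> and \<open>B\<close>, all
  cosets of \<open>N\<close> meet \<open>A\<close> in \<open>q\<close> and \<open>B\<close> in \<open>q'\<close> elements, except that one coset \<open>xN\<close> meets \<open>A\<close> in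
  \<open>q + 1\<close> and its inverse meets \<open>B\<close> in \<open>q' - 1\<close> elements. Counting solutions of \<open>x\<^sub>1 \<dots> x\<^sub>p b = g\<close>
  modulo \<open>p\<close>, with \<open>x\<^sub>1, \<dots>, x\<^sub>p \<in> A\<close>, \<open>b \<in> B\<close> and \<open>g\<close> in the inverse coset of \<open>xN\<close>, yields too many
  elements outside the small set of products \<open>x\<^sup>p b\<close>.\<close>

section \<open>Characters of prime order\<close>

text \<open>Only values on the carrier matter. The number \<open>p\<close> is an exponent rather
  than the exact order, so that characters of order 2 and 5 multiply to one with \<open>p\<close> =
  10.\<close>

definition character :: "('a, 'b) monoid_scheme \<Rightarrow> nat \<Rightarrow> ('a \<Rightarrow> complex) \<Rightarrow> bool" where
  "character G p c \<longleftrightarrow> (\<forall>x \<in> carrier G. c x ^ p = 1) \<and>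
     (\<forall>x \<in> carrier G. \<forall>y \<in> carrier G. c (x \<otimes>\<^bsub>G\<^esub> y) = c x * c y)"

lemma characterD:
  assumes "character G p c"
  shows "x \<in> carrier G \<Longrightarrow> c x ^ p = 1"
    and "x \<in> carrier G \<Longrightarrow> y \<in> carrier G \<Longrightarrow> c (x \<otimes>\<^bsub>G\<^esub> y) = c x * c y"
  using assms by (auto simp: character_def)

lemma character_power: "character G p c \<Longrightarrow> character G p (\<lambda>x. c x ^ i)"
  unfolding character_def by (auto simp: power_mult_distrib simp flip: power_mult)
    (metis mult.commute power_mult power_one)

lemma character_mult:
  "character G p c \<Longrightarrow> character G p d \<Longrightarrow> character G p (\<lambda>x. c x * d x)"
  unfolding character_def by (auto simp: power_mult_distrib)

lemma character_mono: "character G p c \<Longrightarrow> p dvd q \<Longrightarrow> character G q c"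
  unfolding character_def by (auto elim!: dvdE simp: power_mult)

lemma (in group) character_one:
  assumes "character G p c" "p > 0"
  shows "c \<one> = 1"
proof -
  have "c \<one> = c \<one> * c \<one>" using characterD(2)[OF assms(1), of \<one> \<one>] by simp
  moreover have "c \<one> \<noteq> 0" using characterD(1)[OF assms(1), of \<one>] assms(2) by (auto simp: zero_power)
  ultimately show ?thesis by simp
qed

text \<open>Right translation by \<open>inv y\<close> carries the fibre through \<open>y\<close>
  onto the fibre over \<open>e\<close>. The assumption on \<open>f\<close> replaces being a
  homomorphism into a group, so that the count serves both for the \<open>p\<close>-th power map and
  for complex-valued characters.\<close>

lemma (in group) card_image_mult_card_kernel:
  assumes fin: "finite (carrier G)"
    and f: "\<And>x y. x \<in> carrier G \<Longrightarrow> y \<in> carrier G \<Longrightarrow> f x = f y \<longleftrightarrow> f (x \<otimes> inv y) = e"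
  shows "order G = card (f ` carrier G) * card {x \<in> carrier G. f x = e}"
proof -
  have fib: "card {x \<in> carrier G. f x = f y} = card {x \<in> carrier G. f x = e}"
    if y: "y \<in> carrier G" for y
  proof (rule bij_betw_same_card[of "\<lambda>x. x \<otimes> inv y"], rule bij_betw_byWitness[where f' = "\<lambda>x. x \<otimes> y"])
    show "\<forall>a\<in>{x \<in> carrier G. f x = f y}. a \<otimes> inv y \<otimes> y = a"
      using y by (auto simp: m_assoc)
    show "\<forall>a'\<in>{x \<in> carrier G. f x = e}. a' \<otimes> y \<otimes> inv y = a'"
      using y by (auto simp: m_assoc)
    show "(\<lambda>x. x \<otimes> inv y) ` {x \<in> carrier G. f x = f y} \<subseteq> {x \<in> carrier G. f x = e}"
      using y f by auto
    have "f (a \<otimes> y) = f y" if "a \<in> carrier G" "f a = e" for a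
      using f[of "a \<otimes> y" y] that y by (simp add: m_assoc)
    then show "(\<lambda>x. x \<otimes> y) ` {x \<in> carrier G. f x = e} \<subseteq> {x \<in> carrier G. f x = f y}"
      using y by auto
  qed
  have "order G = (\<Sum>v\<in>f ` carrier G. card {x \<in> carrier G. f x = v})"
    using sum.group[OF fin finite_imageI[OF fin] subset_refl, of "\<lambda>_. 1::nat" f]
    by (simp add: order_def)
  also have "\<dots> = (\<Sum>v\<in>f ` carrier G. card {x \<in> carrier G. f x = e})"
    using fib by (intro sum.cong) auto
  finally show ?thesis by simp
qed

lemma (in group) pow_mem_coprime:
  assumes "subgroup M G" "x \<in> carrier G" "x [^] (p::nat) \<in> M" "x [^] (j::nat) \<in> M" "coprime j p"
  shows "x \<in> M"
proof -
  obtain a b where ab: "int j * a + int p * b = 1"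
    using assms(5) by (metis bezout_int coprime_imp_gcd_eq_1 coprime_int_iff mult.commute)
  have "x = x [^] (int j * a + int p * b)" using assms(2) by (simp add: ab)
  also have "\<dots> = (x [^] j) [^] a \<otimes> (x [^] p) [^] b"
    using assms(2) by (simp add: int_pow_mult int_pow_pow int_pow_int flip: int_pow_int)
  also have "\<dots> \<in> M"
    using subgroup_int_pow_closed[OF assms(1)] assms(3,4) by (intro subgroup.m_closed[OF assms(1)])
  finally show ?thesis .
qed

lemma cis_prime_root:
  assumes "p > (1::nat)"
  shows "cis (2 * pi / p) ^ i = 1 \<longleftrightarrow> p dvd i"
proof -
  have "cis (2 * pi / p) ^ i = cis (2 * pi * (i / p))" by (simp add: Complex.DeMoivre mult_ac)
  also have "\<dots> = 1 \<longleftrightarrow> (\<exists>k::int. real i / p = k)"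
  proof
    assume "cis (2 * pi * (i / p)) = 1"
    then have "cos (2 * pi * (i / p)) = 1" by (simp add: complex_eq_iff)
    then obtain k::int where "2 * pi * (i / p) = real_of_int k * 2 * pi"
      using cos_one_2pi_int by blast
    then have "2 * pi * (real i / p) = 2 * pi * k" by (simp add: mult_ac)
    then have "real i / p = k" by (simp only: mult_cancel_left) simp
    then show "\<exists>k::int. real i / p = k" ..
  next
    assume "\<exists>k::int. real i / p = k"
    then show "cis (2 * pi * (i / p)) = 1" by (metis Ints_of_int cis_multiple_2pi)
  qed
  also have "\<dots> \<longleftrightarrow> (\<exists>k::int. int i = k * int p)"
  proof -
    have "real i / p = k \<longleftrightarrow> int i = k * int p" for k :: int
    proof -
      have "real i / p = k \<longleftrightarrow> real_of_int (int i) = real_of_int (k * int p)"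
        using assms by (simp add: field_simps)
      then show ?thesis by (simp only: of_int_eq_iff)
    qed
    then show ?thesis by simp
  qed
  also have "\<dots> \<longleftrightarrow> int p dvd int i" by (auto simp: dvd_def mult.commute)
  also have "\<dots> \<longleftrightarrow> p dvd i" by simp
  finally show ?thesis .
qed

text \<open>A subgroup \<open>M\<close> containing all \<open>p\<close>-th powers and maximal subject to \<open>h \<notin> M\<close>
  has index \<open>p\<close>, and its cosets are represented by the powers of \<open>h\<close>.\<close>

lemma (in comm_group) exists_character:
  assumes fin: "finite (carrier G)" and p: "prime (p::nat)" and h: "h \<in> carrier G"
    and hn: "h \<notin> (\<lambda>x. x [^] p) ` carrier G"
  obtains c where "character G p c" "c h \<noteq> 1"
proof -
  let ?K = "(\<lambda>x. x [^] p) ` carrier G"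
  let ?F = "{M. subgroup M G \<and> ?K \<subseteq> M \<and> h \<notin> M}"
  have K: "subgroup ?K G"
  proof (rule subgroupI)
    show "a \<otimes> b \<in> ?K" if "a \<in> ?K" "b \<in> ?K" for a b
      using that by (auto simp flip: nat_pow_distrib)
    show "inv a \<in> ?K" if "a \<in> ?K" for a
      using that by (auto simp: nat_pow_inv[symmetric])
  qed auto
  have "?F \<subseteq> Pow (carrier G)" using subgroup.subset by auto
  then have "finite ?F" using fin finite_subset by blast
  moreover have "?F \<noteq> {}" using K hn by blast
  ultimately have "Max (card ` ?F) \<in> card ` ?F" by (intro Max_in) auto
  then obtain M where M: "M \<in> ?F" and cM: "card M = Max (card ` ?F)" by auto
  have Mmax: "\<forall>N\<in>?F. card N \<le> card M"
    using \<open>finite ?F\<close> unfolding cM by (intro ballI Max_ge) auto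
  have sub: "subgroup M G" and KM: "?K \<subseteq> M" and hM: "h \<notin> M" using M by auto
  have Mc: "m \<in> carrier G" if "m \<in> M" for m using sub that subgroup.subset by auto
  have pM: "x [^] p \<in> M" if "x \<in> carrier G" for x using KM that by auto
  have powM: "m [^] (n::nat) \<in> M" if "m \<in> M" for m n
    using sub that by (metis int_pow_int subgroup_int_pow_closed)
  have rep: "\<exists>i::nat. \<exists>m\<in>M. x = h [^] i \<otimes> m" if x: "x \<in> carrier G" for x
  proof (cases "x \<in> M")
    case True
    then show ?thesis using x by (intro exI[of _ 0] bexI[of _ x]) auto
  next
    case False
    \<comment> \<open>Adjoining \<open>x\<close> enlarges \<open>M\<close>, so by maximality
      \<open>h\<close> enters: \<open>h\<close> is \<open>x [^] j\<close> times an element of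
      \<open>M\<close>. Here \<open>p\<close> cannot divide \<open>j\<close>, and inverting
      \<open>j\<close> modulo \<open>p\<close> expresses \<open>x\<close> through a power of
      \<open>h\<close>.\<close>
    let ?S = "generate G {x} <#> M"
    have gs: "subgroup (generate G {x}) G" using x by (simp add: generate_is_subgroup)
    have S: "subgroup ?S G" using mult_subgroups[OF gs sub] .
    have "M \<subseteq> ?S"
    proof
      fix m assume "m \<in> M"
      then have "\<one> \<otimes> m \<in> ?S" using subgroup.one_closed[OF gs] unfolding set_mult_def by blast
      then show "m \<in> ?S" using Mc \<open>m \<in> M\<close> by simp
    qed
    moreover have "x \<in> ?S"
    proof -
      have "x \<in> generate G {x}" by (rule generate.incl) simp
      then have "x \<otimes> \<one> \<in> ?S" using subgroup.one_closed[OF sub] unfolding set_mult_def by blast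
      then show ?thesis using x by simp
    qed
    moreover have "finite ?S" using S fin subgroup.subset finite_subset by blast
    ultimately have "card M < card ?S" using False by (intro psubset_card_mono) auto
    then have "?S \<notin> ?F" using Mmax by (meson not_le)
    then have "h \<in> ?S" using S KM \<open>M \<subseteq> ?S\<close> by auto
    then obtain y m where ym: "y \<in> generate G {x}" "m \<in> M" "h = y \<otimes> m"
      unfolding set_mult_def by auto
    then obtain j :: nat where jm: "m \<in> M" "h = x [^] j \<otimes> m"
      using generate_pow_on_finite_carrier[OF fin x] by auto
    have "\<not> p dvd j"
    proof
      assume "p dvd j"
      then obtain t where "j = p * t" by auto
      then have "x [^] j \<in> M" using powM[OF pM[OF x], of t] x by (simp add: nat_pow_pow)
      then show False using jm sub hM by (simp add: subgroup.m_closed)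
    qed
    then have "coprime j p" using p by (metis coprime_commute prime_imp_coprime)
    then obtain i where "[j * i = 1] (mod p)" using cong_solve_coprime_nat[of j p] by auto
    moreover have "p > 1" using p prime_gt_1_nat by blast
    ultimately obtain t where t: "j * i = 1 + p * t"
      by (metis add.commute cong_def div_mult_mod_eq mod_less mult.commute)
    let ?m = "inv ((x [^] p) [^] t \<otimes> m [^] i)"
    have "h [^] i = x \<otimes> ((x [^] p) [^] t \<otimes> m [^] i)"
    proof -
      have "h [^] i = x [^] (j * i) \<otimes> m [^] i"
        using jm x Mc by (simp add: nat_pow_distrib nat_pow_pow)
      also have "x [^] (j * i) = x \<otimes> (x [^] p) [^] t"
        using x by (simp add: t nat_pow_mult[symmetric] nat_pow_pow m_comm)
      finally show ?thesis using x jm Mc by (simp add: m_assoc)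
    qed
    then have "x = h [^] i \<otimes> ?m" using x jm Mc by (simp add: m_assoc)
    moreover have "?m \<in> M" using powM pM[OF x] jm sub
      by (simp add: subgroup.m_closed subgroup.m_inv_closed)
    ultimately show ?thesis by blast
  qed
  define w where "w = cis (2 * pi / p)"
  have w1: "w ^ i = 1 \<longleftrightarrow> p dvd i" for i unfolding w_def
    using cis_prime_root p prime_gt_1_nat by blast
  \<comment> \<open>A coset determines the exponent of \<open>h\<close> modulo \<open>p\<close>,
    since \<open>h\<close> is outside \<open>M\<close> and \<open>h [^] p\<close> inside. As
    \<open>w ^ p = 1\<close>, the choice by \<open>SOME\<close> in the definition of
    \<open>c\<close> below is harmless.\<close>
  have uniq: "w ^ i = w ^ j"
    if "m \<in> M" "m' \<in> M" "h [^] i \<otimes> m = h [^] j \<otimes> m'" "i \<le> j" for i j :: nat and m m'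
  proof -
    obtain d where d: "j = i + d" using \<open>i \<le> j\<close> le_Suc_ex by blast
    have "h [^] i \<otimes> m = h [^] i \<otimes> (h [^] d \<otimes> m')"
      using that h Mc by (simp add: d nat_pow_mult[symmetric] m_assoc)
    then have "m = h [^] d \<otimes> m'" using that h Mc by simp
    then have "h [^] d = m \<otimes> inv m'" using that h Mc by (simp add: m_assoc)
    then have "h [^] d \<in> M" using that sub by (simp add: subgroup.m_closed subgroup.m_inv_closed)
    then have "\<not> coprime d p" using pow_mem_coprime[OF sub h pM[OF h]] hM by blast
    then have "p dvd d" using p by (metis coprime_commute prime_imp_coprime)
    then show ?thesis using w1[of d] by (simp add: d power_add)
  qed
  have uniq': "w ^ i = w ^ j"
    if "m \<in> M" "m' \<in> M" "h [^] i \<otimes> m = h [^] j \<otimes> m'" for i j :: nat and m m'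
    using uniq[OF that] uniq[OF that(2,1) that(3)[symmetric]] by (metis nat_le_linear)
  define c where "c x = w ^ (SOME i. \<exists>m\<in>M. x = h [^] i \<otimes> m)" for x
  have c: "c (h [^] i \<otimes> m) = w ^ i" if "m \<in> M" for i :: nat and m
  proof -
    let ?x = "h [^] i \<otimes> m"
    have "\<exists>m\<in>M. ?x = h [^] (SOME i::nat. \<exists>m\<in>M. ?x = h [^] i \<otimes> m) \<otimes> m"
      by (rule someI[of "\<lambda>i::nat. \<exists>m\<in>M. ?x = h [^] i \<otimes> m" i]) (use that in blast)
    then obtain m' where "m' \<in> M" "?x = h [^] (SOME i::nat. \<exists>m\<in>M. ?x = h [^] i \<otimes> m) \<otimes> m'" ..
    from uniq'[OF that this] show ?thesis unfolding c_def by (rule sym)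
  qed
  show ?thesis
  proof
    show "character G p c" unfolding character_def
    proof (intro conjI ballI)
      fix x assume "x \<in> carrier G"
      then obtain i m where "x = h [^] (i::nat) \<otimes> m" "m \<in> M" using rep by blast
      then have "c x ^ p = (w ^ p) ^ i" using c by (simp add: mult.commute flip: power_mult)
      then show "c x ^ p = 1" using w1[of p] by simp
    next
      fix x y assume "x \<in> carrier G" "y \<in> carrier G"
      then obtain i m j n where xy: "x = h [^] (i::nat) \<otimes> m" "m \<in> M" "y = h [^] (j::nat) \<otimes> n" "n \<in> M"
        using rep by meson
      then have "x \<otimes> y = h [^] (i + j) \<otimes> (m \<otimes> n)"
        using h Mc by (simp add: nat_pow_mult[symmetric] m_ac)
      then show "c (x \<otimes> y) = c x * c y"
        using xy c sub by (simp add: power_add subgroup.m_closed)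
    qed
    have "c h = w" using c[of \<one> 1] subgroup.one_closed[OF sub] h by simp
    then show "c h \<noteq> 1" using w1[of 1] p by auto
  qed
qed

section \<open>Torsion of a noncyclic group and a pair of independent characters\<close>

text \<open>Take for \<open>t\<close> the product of the primes that divide \<open>d\<close> but not
  \<open>s\<close>. Each prime divisor of \<open>d\<close> then divides exactly one of
  \<open>s\<close> and \<open>p * t\<close>, hence not their sum.\<close>

lemma exists_coprime_shift:
  fixes s p d :: nat
  assumes "prime p" "\<not> p dvd s" "d > 0"
  obtains t where "coprime (s + p * t) d"
proof
  let ?T = "{q \<in> prime_factors d. \<not> q dvd s}"
  let ?t = "\<Prod>?T"
  show "coprime (s + p * ?t) d"
  proof (rule ccontr)
    assume "\<not> coprime (s + p * ?t) d"
    then obtain r where r: "r dvd s + p * ?t" "r dvd d" "r \<noteq> 1" by (auto simp: coprime_def)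
    then obtain q where "prime q" "q dvd r" using prime_factor_nat by blast
    then have q: "prime q" "q dvd s + p * ?t" "q dvd d" using r by (auto intro: dvd_trans)
    then have qf: "q \<in> prime_factors d" using assms(3) by (simp add: prime_factors_dvd)
    show False
    proof (cases "q dvd s")
      case True
      then have "q dvd p * ?t" using q(2) dvd_add_right_iff[of q s "p * ?t"] by simp
      moreover have "\<not> q dvd p" using assms(1,2) q(1) True primes_dvd_imp_eq by blast
      ultimately have "q dvd ?t" using q(1) prime_dvd_mult_iff by blast
      then obtain r where "r \<in> ?T" "q dvd r"
        using q(1) prime_dvd_prod_iff[of ?T q "\<lambda>r. r"] by auto
      then show False using True q(1) primes_dvd_imp_eq[of q r] by (force simp: in_prime_factors_iff)
    next
      case False
      then have "q dvd ?t" using qf dvd_prodI[of ?T q "\<lambda>r. r"] by simp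
      then have "q dvd p * ?t" by simp
      then show False using False q(2) dvd_add_left_iff[of q "p * ?t" s] by simp
    qed
  qed
qed

lemma (in group) cyclic_groupI:
  assumes "finite (carrier G)" "g \<in> carrier G" "carrier G \<subseteq> generate G {g}"
  shows "cyclic_group G"
proof -
  have "carrier G = range (\<lambda>n::int. g [^] n)"
    using assms generate_pow[OF assms(2)] by auto
  then show ?thesis using cyclic_group assms(2) by blast
qed

text \<open>Let \<open>g\<close> have maximal order and let \<open>x \<notin> \<langle>g\<rangle>\<close> with \<open>x\<^sup>p = g\<^sup>s\<close>. If \<open>p\<close> does not
  divide \<open>s\<close>, then some \<open>x g\<^sup>t\<close> has a \<open>p\<close>-th power that generates \<open>\<langle>g\<rangle>\<close>, against maximality;
  otherwise \<open>x g\<^bsup>-s/p\<^esup>\<close> has order \<open>p\<close> and lies outside \<open>\<langle>g\<rangle>\<close>.\<close>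

lemma (in comm_group) noncyclic_torsion:
  assumes fin: "finite (carrier G)" and nc: "\<not> cyclic_group G"
  obtains p where "prime (p::nat)" "p ^ 2 \<le> card {x \<in> carrier G. x [^] p = \<one>}"
proof -
  have "Max (ord ` carrier G) \<in> ord ` carrier G" using fin by (intro Max_in) auto
  then obtain g where g: "g \<in> carrier G" and og: "ord g = Max (ord ` carrier G)" by auto
  have gmax: "ord x \<le> ord g" if "x \<in> carrier G" for x
    using fin that unfolding og by (intro Max_ge) auto
  define H where "H = generate G {g}"
  have H: "subgroup H G" unfolding H_def using g by (simp add: generate_is_subgroup)
  have Heq: "H = {g [^] k | k. k \<in> (UNIV :: nat set)}"
    unfolding H_def by (rule generate_pow_on_finite_carrier[OF fin g])
  have cH: "card H = ord g" unfolding H_def using generate_pow_card[OF g] by simp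
  have d0: "ord g > 0" using ord_ge_1[OF fin g] by simp
  have Hc: "y \<in> carrier G" if "y \<in> H" for y using that H subgroup.subset by blast
  have finH: "finite H" by (rule finite_subset[OF _ fin]) (use Hc in auto)
  have powH: "y [^] (n::nat) \<in> H" if "y \<in> H" for y n
    using subgroup_int_pow_closed[OF H that, of "int n"] by (simp add: int_pow_int)
  have gH: "g [^] (n::nat) \<in> H" for n unfolding Heq by auto
  have "\<not> carrier G \<subseteq> H"
  proof
    assume "carrier G \<subseteq> H"
    then show False using cyclic_groupI[OF fin g] nc unfolding H_def by simp
  qed
  then obtain x0 where x0: "x0 \<in> carrier G" "x0 \<notin> H" by (meson subsetI)
  \<comment> \<open>The least \<open>n\<close> is the order of \<open>x0\<close> modulo
    \<open>H\<close>. For a prime \<open>p\<close> dividing it, the power of \<open>x0\<close> with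
    exponent \<open>n / p\<close> lies outside \<open>H\<close>, but its \<open>p\<close>-th power
    lies in \<open>H\<close>.\<close>
  define Q where "Q n \<longleftrightarrow> n > 0 \<and> x0 [^] n \<in> H" for n :: nat
  have "Q (order G)" unfolding Q_def
    using fin x0 pow_order_eq_1 subgroup.one_closed[OF H] by (auto simp: order_gt_0_iff_finite)
  then have "Q (LEAST n. Q n)" by (rule LeastI)
  moreover define n where "n = (LEAST n. Q n)"
  ultimately have Qm: "n > 0" "x0 [^] n \<in> H" unfolding Q_def by auto
  have "n \<noteq> 1" using Qm x0 by auto
  then obtain p where p: "prime p" "p dvd n" using prime_factor_nat by blast
  then have p1: "p > 1" using prime_gt_1_nat by blast
  obtain r where r: "n = p * r" using p by auto
  define x where "x = x0 [^] r"
  have x: "x \<in> carrier G" unfolding x_def using x0 by simp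
  have xp: "x [^] p \<in> H" using Qm x0 r unfolding x_def
    by (simp add: nat_pow_pow mult.commute)
  have xH: "x \<notin> H"
  proof
    assume "x \<in> H"
    moreover have "r > 0" using Qm r by (cases r) auto
    ultimately have "Q r" unfolding Q_def x_def by simp
    then have "n \<le> r" unfolding n_def by (rule Least_le)
    then show False using r p1 \<open>r > 0\<close> by simp
  qed
  have key: "p dvd s" if s: "x [^] p = g [^] s" for s :: nat
  proof (rule ccontr)
    assume "\<not> p dvd s"
    then obtain t where t: "coprime (s + p * t) (ord g)"
      using exists_coprime_shift p(1) d0 by blast
    define y where "y = x \<otimes> g [^] t"
    have y: "y \<in> carrier G" unfolding y_def using x g by simp
    have yp: "y [^] p = g [^] (s + p * t)"
      unfolding y_def using x g s by (simp add: nat_pow_distrib nat_pow_pow nat_pow_mult mult.commute)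
    have "ord (g [^] (s + p * t)) = ord g" using pow_ord_eq_ord_iff[OF fin g] t by blast
    then have oyp: "ord (y [^] p) = ord g" using yp by simp
    have sub1: "generate G {y [^] p} \<subseteq> generate G {y}"
      using generate_pow_on_finite_carrier[OF fin y] generate_pow_on_finite_carrier[OF fin, of "y [^] p"] y
      by (auto simp: nat_pow_pow)
    have sub2: "generate G {y [^] p} \<subseteq> H"
      using generate_pow_on_finite_carrier[OF fin, of "y [^] p"] y g yp powH[OF gH] by auto
    have fy: "finite (generate G {y})"
      using generate_incl[of "{y}"] y by (intro finite_subset[OF _ fin]) auto
    have "card (generate G {y [^] p}) = ord g" using generate_pow_card[of "y [^] p"] y oyp by simp
    then have "generate G {y [^] p} = H" using card_subset_eq[OF finH sub2] cH by simp
    moreover have "card (generate G {y}) \<le> ord g" using generate_pow_card[OF y] gmax[OF y] by simp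
    ultimately have "generate G {y} = H" using card_seteq[OF fy, of H] sub1 cH by simp
    then have "y \<in> H" using generate.incl[of y "{y}" G] by auto
    then have "y \<otimes> inv (g [^] t) \<in> H" using H gH by (simp add: subgroup.m_closed subgroup.m_inv_closed)
    moreover have "y \<otimes> inv (g [^] t) = x" unfolding y_def using x g by (simp add: m_assoc)
    ultimately show False using xH by simp
  qed
  obtain s where s: "x [^] p = g [^] (s::nat)" using xp Heq by auto
  have ps: "p dvd s" using key[OF s] .
  \<comment> \<open>The exponents \<open>s\<close> and \<open>s + ord g\<close> give the same power
    of \<open>g\<close>, so \<open>key\<close> applies to both and \<open>p\<close> divides the
    difference \<open>ord g\<close>. This is what provides an element \<open>z\<close> of order
    \<open>p\<close> inside \<open>H\<close>.\<close>
  have "x [^] p = g [^] (s + ord g)" using s g by (simp flip: nat_pow_mult)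
  then have pd: "p dvd ord g" using key ps by (metis dvd_add_right_iff)
  obtain u where u: "s = p * u" using ps by auto
  define y where "y = x \<otimes> inv (g [^] u)"
  have y: "y \<in> carrier G" unfolding y_def using x g by simp
  have yp: "y [^] p = \<one>" unfolding y_def using x g s u
    by (simp add: nat_pow_distrib nat_pow_inv[symmetric] nat_pow_pow mult.commute)
       (metis g mult.commute nat_pow_closed nat_pow_inv nat_pow_pow r_inv)
  have yH: "y \<notin> H"
  proof
    assume "y \<in> H"
    then have "y \<otimes> g [^] u \<in> H" using H gH by (simp add: subgroup.m_closed)
    moreover have "y \<otimes> g [^] u = x" unfolding y_def using x g by (simp add: m_assoc)
    ultimately show False using xH by simp
  qed
  obtain e where e: "ord g = p * e" using pd by auto
  define z where "z = g [^] e"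
  have z: "z \<in> carrier G" "z \<in> H" unfolding z_def using g gH by auto
  have "e > 0" using e d0 by (cases e) auto
  have oz: "ord z = p" unfolding z_def using ord_pow[OF g, of e] e \<open>e > 0\<close> by simp
  then have zp: "z [^] p = \<one>" using z(1) pow_ord_eq_1 by metis
  \<comment> \<open>With \<open>z\<close> of order \<open>p\<close> inside \<open>H\<close> and
    \<open>y\<close> outside \<open>H\<close>, both killed by \<open>p\<close>, these products are
    \<open>p ^ 2\<close> different elements of the \<open>p\<close>-torsion.\<close>
  let ?f = "\<lambda>(i::nat, j::nat). z [^] i \<otimes> y [^] j"
  have inj: "inj_on ?f ({..<p} \<times> {..<p})"
  proof -
    have *: "j = j' \<and> i = i'"
      if "i < p" "j < p" "i' < p" "j' < p" "j \<le> j'" "z [^] i \<otimes> y [^] j = z [^] i' \<otimes> y [^] j'"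
      for i j i' j' :: nat
    proof -
      obtain k where k: "j' = j + k" using \<open>j \<le> j'\<close> le_Suc_ex by blast
      have "z [^] i \<otimes> y [^] j = (z [^] i' \<otimes> y [^] k) \<otimes> y [^] j"
        using that(6) y z by (simp add: k m_assoc nat_pow_mult add.commute)
      then have eq: "z [^] i = z [^] i' \<otimes> y [^] k" using y z by simp
      then have "y [^] k = inv (z [^] i') \<otimes> z [^] i" using y z by (simp add: m_assoc[symmetric])
      then have "y [^] k \<in> H" using z powH H by (simp add: subgroup.m_closed subgroup.m_inv_closed)
      then have "\<not> coprime k p"
        using pow_mem_coprime[OF H y, of p k] yp subgroup.one_closed[OF H] yH by auto
      then have "p dvd k" using p(1) by (metis coprime_commute prime_imp_coprime)
      moreover have "k < p" using that k by simp
      ultimately have "k = 0" by (meson dvd_imp_le gr0I not_le)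
      then have "z [^] i = z [^] i'" using eq z by simp
      moreover have "inj_on (\<lambda>i::nat. z [^] i) {0..ord z - 1}" by (rule ord_inj[OF z(1)])
      moreover have "i \<in> {0..ord z - 1}" "i' \<in> {0..ord z - 1}" using that oz by auto
      ultimately have "i = i'" unfolding inj_on_def by blast
      then show ?thesis using k \<open>k = 0\<close> by simp
    qed
    show ?thesis
    proof (rule inj_onI, clarsimp)
      fix i j i' j'
      assume "i < p" "j < p" "i' < p" "j' < p" "z [^] i \<otimes> y [^] j = z [^] i' \<otimes> y [^] j'"
      then show "i = i' \<and> j = j'" using *[of i j i' j'] *[of i' j' i j] by (metis nat_le_linear)
    qed
  qed
  have "?f ` ({..<p} \<times> {..<p}) \<subseteq> {x \<in> carrier G. x [^] p = \<one>}"
  proof -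
    have "(z [^] i \<otimes> y [^] j) [^] p = \<one>" for i j :: nat
    proof -
      have "(z [^] i) [^] p = (z [^] p) [^] i" "(y [^] j) [^] p = (y [^] p) [^] j"
        using y z by (simp_all add: nat_pow_pow mult.commute)
      then show ?thesis using y z zp yp by (simp add: nat_pow_distrib)
    qed
    then show ?thesis using y z by auto
  qed
  then have "card ({..<p} \<times> {..<p}) \<le> card {x \<in> carrier G. x [^] p = \<one>}"
    using fin card_inj_on_le[OF inj] by simp
  then have "p ^ 2 \<le> card {x \<in> carrier G. x [^] p = \<one>}" by (simp add: power2_eq_square)
  then show ?thesis using that p(1) by blast
qed

lemma (in comm_group) order_eq_powers_mult_torsion:
  assumes "finite (carrier G)"
  shows "order G = card ((\<lambda>x. x [^] (p::nat)) ` carrier G) * card {x \<in> carrier G. x [^] p = \<one>}"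
proof (rule card_image_mult_card_kernel[OF assms])
  fix x y assume xy: "x \<in> carrier G" "y \<in> carrier G"
  have "(x \<otimes> inv y) [^] p = x [^] p \<otimes> inv (y [^] p)"
    using xy by (simp add: nat_pow_distrib nat_pow_inv)
  moreover have "x [^] p \<otimes> inv (y [^] p) = \<one> \<longleftrightarrow> x [^] p = y [^] p"
    using xy by (metis inv_closed nat_pow_closed inv_equality inv_inv l_inv r_inv)
  ultimately show "(x [^] p = y [^] p) = ((x \<otimes> inv y) [^] p = \<one>)" by simp
qed

lemma (in comm_group) order_eq_image_mult_kernel:
  assumes "finite (carrier G)" "character G p c" "p > 0"
  shows "order G = card (c ` carrier G) * card {x \<in> carrier G. c x = 1}"
proof (rule card_image_mult_card_kernel[OF assms(1)])
  fix x y assume xy: "x \<in> carrier G" "y \<in> carrier G"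
  have "c (x \<otimes> inv y) * c y = c x"
    using xy characterD(2)[OF assms(2), of "x \<otimes> inv y" y] by (simp add: m_assoc)
  moreover have "c y \<noteq> 0" using characterD(1)[OF assms(2) xy(2)] assms(3) by (auto simp: zero_power)
  ultimately show "(c x = c y) = (c (x \<otimes> inv y) = 1)" by auto
qed

text \<open>The \<open>p\<close>-th powers have index at least \<open>p ^ 2\<close>, while the
  kernel of \<open>c1\<close> has index at most \<open>p\<close>. So this kernel contains some
  \<open>h\<close> that is not a \<open>p\<close>-th power, and a character \<open>c2\<close>
  nontrivial at \<open>h\<close> is independent of \<open>c1\<close>.\<close>

lemma (in comm_group) noncyclic_character_pair:
  assumes fin: "finite (carrier G)" and nc: "\<not> cyclic_group G"
  obtains p c1 c2 g h where "prime (p::nat)" "character G p c1" "character G p c2"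
    "g \<in> carrier G" "c1 g \<noteq> 1" "h \<in> carrier G" "c1 h = 1" "c2 h \<noteq> 1"
proof -
  obtain p where p: "prime p" "p ^ 2 \<le> card {x \<in> carrier G. x [^] p = \<one>}"
    using noncyclic_torsion[OF fin nc] .
  let ?K = "(\<lambda>x. x [^] p) ` carrier G"
  have p1: "p > 1" using p(1) prime_gt_1_nat by blast
  have "\<one> \<in> carrier G" by simp
  then have K0: "card ?K > 0" using fin card_gt_0_iff by blast
  have big: "card ?K * p ^ 2 \<le> order G"
    using order_eq_powers_mult_torsion[OF fin, of p] p(2) by simp
  have "card ?K * 1 < card ?K * p ^ 2"
    using K0 one_less_power[OF p1, of 2] by (intro mult_strict_left_mono) auto
  then have "card ?K < order G" using big by (simp only: mult_1_right less_le_trans)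
  moreover have "finite ?K" using fin by simp
  ultimately have "\<not> carrier G \<subseteq> ?K" unfolding order_def by (meson card_mono not_le)
  then obtain g where g: "g \<in> carrier G" "g \<notin> ?K" by auto
  obtain c1 where c1: "character G p c1" "c1 g \<noteq> 1" using exists_character[OF fin p(1) g] .
  have "c1 ` carrier G \<subseteq> {z. z ^ p = 1}" using characterD(1)[OF c1(1)] by auto
  then have "card (c1 ` carrier G) \<le> card {z::complex. z ^ p = 1}"
    using p1 by (intro card_mono finite_roots_unity) auto
  then have "card (c1 ` carrier G) \<le> p" using card_roots_unity_eq[of p] p1 by simp
  then have "order G \<le> p * card {x \<in> carrier G. c1 x = 1}"
    using order_eq_image_mult_kernel[OF fin c1(1)] p1 by simp
  with big have "card ?K * p ^ 2 \<le> p * card {x \<in> carrier G. c1 x = 1}" by (rule le_trans)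
  then have "p * (card ?K * p) \<le> p * card {x \<in> carrier G. c1 x = 1}"
    by (simp add: power2_eq_square mult_ac)
  then have "card ?K * p \<le> card {x \<in> carrier G. c1 x = 1}" using p1 by simp
  moreover have "card ?K * 1 < card ?K * p" using K0 p1 by (intro mult_strict_left_mono) auto
  ultimately have "card ?K < card {x \<in> carrier G. c1 x = 1}" by (simp only: mult_1_right less_le_trans)
  moreover have "finite ?K" using fin by simp
  ultimately have "\<not> {x \<in> carrier G. c1 x = 1} \<subseteq> ?K" by (meson card_mono not_le)
  then obtain h where h: "h \<in> carrier G" "c1 h = 1" "h \<notin> ?K" by auto
  obtain c2 where "character G p c2" "c2 h \<noteq> 1" using exists_character[OF fin p(1) h(1,3)] .
  then show ?thesis using that p(1) c1 g(1) h by blast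
qed

section \<open>Character sums over a near-factorization\<close>

lemma sum_powers_root_of_unity:
  fixes z :: complex
  assumes "z ^ p = 1"
  shows "(\<Sum>i<p. z ^ i) = (if z = 1 then of_nat p else 0)"
  using assms by (simp add: sum_gp_strict)

text \<open>The powers of a \<open>p\<close>-th root of unity sum to \<open>p\<close> or 0 according
  to whether it is 1. Through this detector, here and in the version for two values below, all
  counts become character sums.\<close>

lemma card_eq_sum_roots_of_unity:
  fixes v :: "'x \<Rightarrow> complex"
  assumes "finite T" "\<And>x. x \<in> T \<Longrightarrow> v x ^ p = 1"
  shows "of_nat (p * card {x \<in> T. v x = 1}) = (\<Sum>i<p. \<Sum>x\<in>T. v x ^ i)"
proof -
  have "(\<Sum>i<p. \<Sum>x\<in>T. v x ^ i) = (\<Sum>x\<in>T. \<Sum>i<p. v x ^ i)" by (rule sum.swap)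
  also have "\<dots> = (\<Sum>x\<in>T. if v x = 1 then of_nat p else 0)"
    using assms(2) by (intro sum.cong) (auto simp: sum_powers_root_of_unity)
  also have "\<dots> = of_nat (p * card {x \<in> T. v x = 1})"
    using assms(1) by (simp add: sum.If_cases Int_def)
  finally show ?thesis by simp
qed

lemma card_eq_sum_roots_of_unity2:
  fixes u v :: "'x \<Rightarrow> complex"
  assumes "finite T" "\<And>x. x \<in> T \<Longrightarrow> u x ^ p = 1" "\<And>x. x \<in> T \<Longrightarrow> v x ^ p = 1"
  shows "of_nat (p\<^sup>2 * card {x \<in> T. u x = 1 \<and> v x = 1}) =
    (\<Sum>i<p. \<Sum>j<p. \<Sum>x\<in>T. u x ^ i * v x ^ j)"
proof -
  let ?d = "\<lambda>z::complex. if z = 1 then of_nat p else (0::complex)"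
  have "(\<Sum>i<p. \<Sum>j<p. \<Sum>x\<in>T. u x ^ i * v x ^ j) = (\<Sum>i<p. \<Sum>x\<in>T. \<Sum>j<p. u x ^ i * v x ^ j)"
    by (intro sum.cong refl sum.swap)
  also have "\<dots> = (\<Sum>x\<in>T. \<Sum>i<p. \<Sum>j<p. u x ^ i * v x ^ j)" by (rule sum.swap)
  also have "\<dots> = (\<Sum>x\<in>T. (\<Sum>i<p. u x ^ i) * (\<Sum>j<p. v x ^ j))"
    by (simp add: sum_product)
  also have "\<dots> = (\<Sum>x\<in>T. if u x = 1 \<and> v x = 1 then of_nat (p\<^sup>2) else 0)"
    using assms(2,3) by (intro sum.cong) (auto simp: sum_powers_root_of_unity power2_eq_square)
  also have "\<dots> = of_nat (p\<^sup>2 * card {x \<in> T. u x = 1 \<and> v x = 1})"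
    using assms(1) by (simp add: sum.If_cases Int_def)
  finally show ?thesis by simp
qed

lemma root_of_unity_coprime:
  fixes z :: complex
  assumes "z ^ p = 1" "z ^ i = 1" "coprime i p"
  shows "z = 1"
proof -
  have z0: "z \<noteq> 0" if "p > 0" using assms(1) that by (auto simp: zero_power)
  obtain a b where ab: "int i * a + int p * b = 1"
    using assms(3) by (metis bezout_int coprime_imp_gcd_eq_1 coprime_int_iff mult.commute)
  show ?thesis
  proof (cases "p = 0")
    case True
    then have "i = 1" using assms(3) by simp
    then show ?thesis using assms(2) by simp
  next
    case False
    then have "z = z powi (int i * a + int p * b)" by (simp add: ab)
    also have "\<dots> = (z ^ i) powi a * (z ^ p) powi b"
      using z0 False by (simp add: power_int_add power_int_mult)
    finally show ?thesis using assms by simp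
  qed
qed

text \<open>Multiplication by \<open>u\<close> permutes the nonzero residues modulo
  \<open>p\<close>. This is the elementary form of the Galois invariance of a norm.\<close>

lemma prod_root_of_unity_permute:
  fixes S :: "nat \<Rightarrow> complex"
  assumes p: "prime p" and u: "\<not> p dvd u" and S: "\<And>i. S (i mod p) = S i"
  shows "(\<Prod>t\<in>{1..<p}. S (t * u)) = (\<Prod>t\<in>{1..<p}. S t)"
proof -
  let ?f = "\<lambda>t. (t * u) mod p"
  have p1: "p > 1" using p prime_gt_1_nat by blast
  have cop: "coprime u p" using p u by (metis coprime_commute prime_imp_coprime)
  have "inj_on ?f {1..<p}"
  proof (rule inj_onI)
    fix s t assume st: "s \<in> {1..<p}" "t \<in> {1..<p}" "(s * u) mod p = (t * u) mod p"
    then have "[s * u = t * u] (mod p)" by (simp add: cong_def)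
    then have "[s = t] (mod p)" using cop cong_mult_rcancel_nat by blast
    then show "s = t" using st by (simp add: cong_def)
  qed
  moreover have "?f ` {1..<p} \<subseteq> {1..<p}"
  proof (rule image_subsetI)
    fix t assume t: "t \<in> {1..<p}"
    then have "\<not> p dvd t" by (auto dest: dvd_imp_le)
    then have "\<not> p dvd t * u" using u p by (simp add: prime_dvd_mult_iff)
    then show "(t * u) mod p \<in> {1..<p}" using p1 by (simp add: dvd_eq_mod_eq_0)
  qed
  ultimately have "bij_betw ?f {1..<p} {1..<p}"
    by (simp add: bij_betw_def endo_inj_surj)
  from prod.reindex_bij_betw[OF this, of S] show ?thesis by (simp add: S)
qed

lemma (in comm_group) sum_character_carrier:
  assumes "character G p c" "g \<in> carrier G" "c g \<noteq> 1"
  shows "(\<Sum>x\<in>carrier G. c x) = 0"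
proof -
  have "bij_betw (\<lambda>x. g \<otimes> x) (carrier G) (carrier G)"
    by (rule bij_betw_byWitness[where f' = "\<lambda>x. inv g \<otimes> x"])
      (use assms(2) in \<open>auto simp: m_assoc[symmetric]\<close>)
  from sum.reindex_bij_betw[OF this, of c] have "(\<Sum>x\<in>carrier G. c x) = (\<Sum>x\<in>carrier G. c (g \<otimes> x))"
    by simp
  also have "\<dots> = c g * (\<Sum>x\<in>carrier G. c x)"
    using characterD(2)[OF assms(1,2)] by (simp add: sum_distrib_left)
  finally show ?thesis using assms(3) by (metis mult_cancel_right1 mult.commute)
qed

lemma (in comm_group) character_nontrivial_dvd_order:
  assumes "character G p c" "prime p" "g \<in> carrier G" "c g \<noteq> 1"
  shows "p dvd order G"
proof -
  have p0: "p > 0" using assms(2) prime_gt_0_nat by blast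
  have "c (g [^] n) = c g ^ n" for n :: nat
    using assms(3) by (induction n) (simp_all add: character_one[OF assms(1) p0] characterD(2)[OF assms(1)])
  then have "c g ^ order G = 1"
    using pow_order_eq_1[OF assms(3)] character_one[OF assms(1) p0] by metis
  then have "\<not> coprime (order G) p"
    using root_of_unity_coprime characterD(1)[OF assms(1,3)] assms(4) by blast
  then show ?thesis using assms(2) by (metis coprime_commute prime_imp_coprime)
qed

definition chi_sum :: "'a set \<Rightarrow> ('a \<Rightarrow> complex) \<Rightarrow> complex" where
  "chi_sum T c = (\<Sum>x\<in>T. c x)"

text \<open>The norm of a character sum is expanded over tuples; Galois invariance makes it
  congruent to \<open>|A|\<^bsup>p-1\<^esup>\<close> modulo \<open>p\<close>.\<close>

lemma chi_sum_norm_expand: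
  fixes c :: "'a \<Rightarrow> complex"
  assumes "finite A" "p > 0"
  shows "(\<Sum>x\<in>PiE {1..<p} (\<lambda>_. A). (\<Prod>t\<in>{1..<p}. c (x t) ^ t) ^ u)
    = (\<Prod>t\<in>{1..<p}. chi_sum A (\<lambda>x. c x ^ (t * u)))"
  unfolding chi_sum_def
  by (subst prod_sum_PiE) (simp_all add: assms power_mult flip: prod_power_distrib)

lemma chi_sum_norm_int:
  fixes c :: "'a \<Rightarrow> complex"
  assumes p: "prime p" and A: "finite A" and c: "\<And>x. x \<in> A \<Longrightarrow> c x ^ p = 1"
  obtains m :: nat where
    "(\<Prod>t\<in>{1..<p}. chi_sum A (\<lambda>x. c x ^ t)) = of_int (int (card A) ^ (p - 1) - int p * int m)"
proof -
  have p1: "p > 1" using p prime_gt_1_nat by blast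
  define N where "N = (\<Prod>t\<in>{1..<p}. chi_sum A (\<lambda>x. c x ^ t))"
  define T where "T = PiE {1..<p} (\<lambda>_. A)"
  define v where "v x = (\<Prod>t\<in>{1..<p}. c (x t) ^ t)" for x :: "nat \<Rightarrow> 'a"
  define w where "w = cis (2 * pi / p)"
  have wp: "w ^ p = 1" and w1: "w \<noteq> 1"
    using cis_prime_root[OF p1, of p] cis_prime_root[OF p1, of 1] p1 unfolding w_def by auto
  have w0: "w \<noteq> 0" unfolding w_def by simp
  have fX: "finite T" unfolding T_def using A by (intro finite_PiE) auto
  have xA: "x t \<in> A" if "x \<in> T" "t \<in> {1..<p}" for x t using that unfolding T_def by auto
  have vp: "v x ^ p = 1" if "x \<in> T" for x
  proof -
    have "v x ^ p = (\<Prod>t\<in>{1..<p}. (c (x t) ^ p) ^ t)"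
      unfolding v_def by (simp add: prod_power_distrib mult.commute flip: power_mult)
    also have "\<dots> = 1" using c xA[OF that] by (intro prod.neutral) auto
    finally show ?thesis .
  qed
  have Smod: "chi_sum A (\<lambda>x. c x ^ (i mod p)) = chi_sum A (\<lambda>x. c x ^ i)" for i
  proof -
    have "c x ^ i = c x ^ (i mod p)" if "x \<in> A" for x
    proof -
      have "c x ^ i = c x ^ (p * (i div p) + i mod p)" by simp
      also have "\<dots> = (c x ^ p) ^ (i div p) * c x ^ (i mod p)" by (simp only: power_add power_mult)
      finally show ?thesis using c[OF that] by simp
    qed
    then show ?thesis unfolding chi_sum_def by (intro sum.cong) auto
  qed
  have sv: "(\<Sum>x\<in>T. v x ^ u) = N" if "u \<in> {1..<p}" for u
  proof -
    have nd: "\<not> p dvd u" using that by (auto dest: dvd_imp_le)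
    show ?thesis using chi_sum_norm_expand[OF A, of p c u] p1
        prod_root_of_unity_permute[OF p nd, of "\<lambda>i. chi_sum A (\<lambda>x. c x ^ i)", OF Smod]
      unfolding N_def T_def v_def by simp
  qed
  \<comment> \<open>The count \<open>m\<close> of tuples with value \<open>w\<close> is computed
    with the detector: the term \<open>u = 0\<close> gives \<open>card T\<close>, and the others
    give \<open>N\<close> times the sum of the nontrivial powers of \<open>inverse w\<close>, that
    is \<open>- N\<close>. So \<open>N\<close> is an integer, without any theory of algebraic
    integers.\<close>
  define m where "m = card {x \<in> T. v x * inverse w = 1}"
  have "of_nat (p * m) = (\<Sum>u<p. \<Sum>x\<in>T. (v x * inverse w) ^ u)"
    unfolding m_def using vp wp by (intro card_eq_sum_roots_of_unity fX) (simp add: power_mult_distrib power_inverse)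
  also have "\<dots> = (\<Sum>u<p. inverse w ^ u * (\<Sum>x\<in>T. v x ^ u))"
    by (simp add: power_mult_distrib sum_distrib_left mult.commute)
  also have "\<dots> = of_nat (card T) + (\<Sum>u\<in>{1..<p}. inverse w ^ u * (\<Sum>x\<in>T. v x ^ u))"
  proof -
    have "{..<p} = insert 0 {1..<p}" using p1 by auto
    then show ?thesis by simp
  qed
  also have "(\<Sum>u\<in>{1..<p}. inverse w ^ u * (\<Sum>x\<in>T. v x ^ u)) = (\<Sum>u\<in>{1..<p}. inverse w ^ u * N)"
    using sv by (intro sum.cong) auto
  also have "\<dots> = (\<Sum>u\<in>{1..<p}. inverse w ^ u) * N" by (simp add: sum_distrib_right)
  also have "(\<Sum>u\<in>{1..<p}. inverse w ^ u) = -1"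
  proof -
    have "{..<p} = insert 0 {1..<p}" using p1 by auto
    moreover have "(\<Sum>u<p. inverse w ^ u) = 0"
      using w1 wp by (subst sum_powers_root_of_unity) (auto simp: power_inverse)
    ultimately have "1 + (\<Sum>u\<in>{1..<p}. inverse w ^ u) = 0" by simp
    then show ?thesis by (simp add: add_eq_0_iff)
  qed
  finally have "N = of_nat (card T) - of_nat (p * m)" by simp
  also have "card T = card A ^ (p - 1)" unfolding T_def by (simp add: card_PiE)
  finally have "N = of_int (int (card A) ^ (p - 1) - int p * int m)" by simp
  then show ?thesis using that unfolding N_def by blast
qed

section \<open>Near-factorizations of a finite abelian group\<close>

locale near_fact = comm_group G for G (structure) +
  fixes A B
  assumes fin: "finite (carrier G)" and nf: "near_factorization G A B"
begin

lemma A_carrier: "A \<subseteq> carrier G" and B_carrier: "B \<subseteq> carrier G"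
  and set_mult_AB: "A <#> B = carrier G - {\<one>}"
  using nf by (auto simp: near_factorization_def)

lemma A_in: "x \<in> A \<Longrightarrow> x \<in> carrier G" and B_in: "x \<in> B \<Longrightarrow> x \<in> carrier G"
  using A_carrier B_carrier by auto

lemma finite_A: "finite A" and finite_B: "finite B"
  using A_carrier B_carrier fin finite_subset by auto

lemma card_eq: "card A * card B + 1 = order G"
proof -
  have "order G > 0" using fin by (simp add: order_gt_0_iff_finite)
  moreover have "card A * card B = order G - 1" using nf by (simp add: near_factorization_def)
  ultimately show ?thesis by simp
qed

text \<open>The product map is onto by definition, and both sides have the same finite size; so
  factorizations are unique.\<close>

lemma bij_mult: "bij_betw (\<lambda>(a, b). a \<otimes> b) (A \<times> B) (carrier G - {\<one>})"
proof -
  have im: "(\<lambda>(a, b). a \<otimes> b) ` (A \<times> B) = carrier G - {\<one>}"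
    unfolding set_mult_AB[symmetric] set_mult_def by fastforce
  have "card (carrier G - {\<one>}) = card (A \<times> B)"
    using card_eq by (simp add: card_cartesian_product order_def card_Diff_singleton)
  then have "inj_on (\<lambda>(a, b). a \<otimes> b) (A \<times> B)"
    using finite_A finite_B by (intro eq_card_imp_inj_on) (simp_all only: im finite_SigmaI)
  then show ?thesis using im by (simp add: bij_betw_def)
qed

lemma sum_mult: "(\<Sum>a\<in>A. \<Sum>b\<in>B. f (a \<otimes> b)) = (\<Sum>g\<in>carrier G - {\<one>}. f g)"
  using sum.reindex_bij_betw[OF bij_mult, of f] by (simp add: sum.cartesian_product case_prod_unfold)

lemma near_fact_swap: "near_fact G B A"
proof unfold_locales
  have "B <#> A = (\<Union>b\<in>B. \<Union>a\<in>A. {a \<otimes> b})"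
    unfolding set_mult_def using A_in B_in by (intro SUP_cong refl) (simp add: m_comm)
  also have "\<dots> = A <#> B" unfolding set_mult_def by (rule SUP_commute)
  finally have "B <#> A = A <#> B" .
  then show "near_factorization G B A" using nf by (simp add: near_factorization_def mult.commute)
qed (rule fin)

lemma chi_sum_mult:
  assumes "character G p c" "p > 0" "g \<in> carrier G" "c g \<noteq> 1"
  shows "chi_sum A c * chi_sum B c = -1"
proof -
  have "chi_sum A c * chi_sum B c = (\<Sum>a\<in>A. \<Sum>b\<in>B. c (a \<otimes> b))"
    unfolding chi_sum_def sum_product
    using A_in B_in by (intro sum.cong refl) (simp add: characterD(2)[OF assms(1)])
  also have "\<dots> = (\<Sum>g\<in>carrier G - {\<one>}. c g)" by (rule sum_mult)
  also have "\<dots> = (\<Sum>g\<in>carrier G. c g) - c \<one>" using fin by (simp add: sum_diff1)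
  also have "\<dots> = -1"
    using sum_character_carrier[OF assms(1,3,4)] character_one[OF assms(1,2)] by simp
  finally show ?thesis .
qed

text \<open>The norms for \<open>A\<close> and \<open>B\<close> are integers with product
  \<open>(-1) ^ (p - 1) = 1\<close>, so each is 1 or -1. Since \<open>p\<close> divides
  \<open>card A * card B + 1\<close>, it does not divide \<open>card A\<close>, and Fermat makes the
  norm for \<open>A\<close> congruent to 1 modulo \<open>p\<close>; for \<open>p > 2\<close> this
  excludes -1.\<close>

lemma norm_chi_sum:
  assumes c: "character G p c" and p: "prime p" "p > 2" and g: "g \<in> carrier G" "c g \<noteq> 1"
  shows "(\<Prod>t\<in>{1..<p}. chi_sum A (\<lambda>x. c x ^ t)) = 1"
proof -
  obtain m where m: "(\<Prod>t\<in>{1..<p}. chi_sum A (\<lambda>x. c x ^ t)) = of_int (int (card A) ^ (p - 1) - int p * int m)"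
    using chi_sum_norm_int[OF p(1) finite_A, of c] characterD(1)[OF c] A_in by blast
  obtain n where n: "(\<Prod>t\<in>{1..<p}. chi_sum B (\<lambda>x. c x ^ t)) = of_int (int (card B) ^ (p - 1) - int p * int n)"
    using chi_sum_norm_int[OF p(1) finite_B, of c] characterD(1)[OF c] B_in by blast
  define a where "a = int (card A) ^ (p - 1) - int p * int m"
  define b where "b = int (card B) ^ (p - 1) - int p * int n"
  have "(\<Prod>t\<in>{1..<p}. chi_sum A (\<lambda>x. c x ^ t)) * (\<Prod>t\<in>{1..<p}. chi_sum B (\<lambda>x. c x ^ t))
    = (\<Prod>t\<in>{1..<p}. -1)"
    unfolding prod.distrib[symmetric]
  proof (intro prod.cong refl)
    fix t assume t: "t \<in> {1..<p}"
    then have "coprime t p" using p by (metis atLeastLessThan_iff coprime_commute dvd_imp_le not_le prime_imp_coprime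
      less_le_trans zero_less_one)
    then have "c g ^ t \<noteq> 1" using root_of_unity_coprime[of "c g" p t] characterD(1)[OF c g(1)] g(2) by blast
    then show "chi_sum A (\<lambda>x. c x ^ t) * chi_sum B (\<lambda>x. c x ^ t) = -1"
      using chi_sum_mult[OF character_power[OF c, of t] _ g(1)] p by simp
  qed
  also have "\<dots> = (1::complex)"
    using prime_odd_nat[OF p] by (simp add: uminus_power_if)
  finally have "of_int (a * b) = (1::complex)" using m n unfolding a_def b_def by simp
  then have "a * b = 1" by (metis of_int_eq_1_iff)
  then have a1: "a = 1 \<or> a = -1" by (auto simp: zmult_eq_1_iff)
  have "p dvd card A * card B + 1"
    using character_nontrivial_dvd_order[OF c p(1) g] card_eq by simp
  then have "\<not> p dvd card A" using p by (metis dvd_add_right_iff dvd_mult2 nat_dvd_1_iff_1 not_prime_1)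
  then have "[card A ^ (p - 1) = 1] (mod p)" by (rule fermat_theorem[OF p(1)])
  then have "[int (card A) ^ (p - 1) = 1] (mod int p)" by (metis cong_int_iff of_nat_1 of_nat_power)
  then have "int p dvd int (card A) ^ (p - 1) - 1" by (simp add: cong_iff_dvd_diff)
  then have "int p dvd (int (card A) ^ (p - 1) - 1) - int p * int m" by simp
  then have "int p dvd a - 1" by (simp add: a_def algebra_simps)
  moreover have "\<not> int p dvd -2" using p by (auto dest!: zdvd_imp_le)
  ultimately have "a = 1" using a1 by auto
  then show ?thesis using m unfolding a_def by simp
qed

text \<open>A character of exponent 2 takes only the values 1 and -1, so both sums are integers, and
  their product is -1. Unlike for odd \<open>p\<close>, the sign stays open.\<close>

lemma sum_order2:
  assumes c: "character G 2 c" and g: "g \<in> carrier G" "c g \<noteq> 1"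
  shows "chi_sum A c = 1 \<or> chi_sum A c = -1"
proof -
  have int: "chi_sum Y c \<in> \<int>" if "Y \<subseteq> carrier G" for Y
    unfolding chi_sum_def
  proof (rule Ints_sum)
    fix x assume "x \<in> Y"
    then have "c x = 1 \<or> c x = -1"
      using that characterD(1)[OF c, of x] by (auto simp: power2_eq_1_iff)
    then show "c x \<in> \<int>" by auto
  qed
  obtain a where a: "chi_sum A c = of_int a" using int[OF A_carrier] by (auto elim: Ints_cases)
  obtain b where b: "chi_sum B c = of_int b" using int[OF B_carrier] by (auto elim: Ints_cases)
  have "of_int (a * b) = (of_int (-1) :: complex)" using chi_sum_mult[OF c _ g] a b by simp
  then have "a * (-b) = 1" by (simp only: of_int_eq_iff)
  then have "a = 1 \<or> a = -1" using zmult_eq_1_iff[of a "-b"] by blast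
  then show ?thesis using a by auto
qed

end

section \<open>Two independent characters of prime order\<close>

locale near_fact_pair = near_fact +
  fixes p c1 c2
  assumes p: "prime (p::nat)" and c1: "character G p c1" and c2: "character G p c2"
    and indep: "\<And>i j. i < p \<Longrightarrow> j < p \<Longrightarrow> (i, j) \<noteq> (0, 0) \<Longrightarrow> \<exists>g\<in>carrier G. c1 g ^ i * c2 g ^ j \<noteq> 1"
begin

abbreviation chr where "chr i j \<equiv> (\<lambda>x. c1 x ^ i * c2 x ^ j)"

lemma p_gt_1: "p > 1" using p prime_gt_1_nat by blast

lemma chr_character: "character G p (chr i j)"
  by (intro character_mult character_power c1 c2)

lemma near_fact_pair_swap: "near_fact_pair G B A p c1 c2"
  by (intro near_fact_pair.intro near_fact_swap near_fact_pair_axioms.intro p c1 c2 indep)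

lemma sum_pair_split:
  fixes f :: "nat \<Rightarrow> nat \<Rightarrow> complex"
  assumes "\<And>i j. i < p \<Longrightarrow> j < p \<Longrightarrow> (i, j) \<noteq> (0, 0) \<Longrightarrow> f i j = z"
  shows "(\<Sum>i<p. \<Sum>j<p. f i j) = f 0 0 + of_nat (p\<^sup>2 - 1) * z"
proof -
  have "(\<Sum>i<p. \<Sum>j<p. f i j) = (\<Sum>x\<in>{..<p} \<times> {..<p}. f (fst x) (snd x))"
    by (simp add: sum.cartesian_product case_prod_unfold)
  also have "\<dots> = f 0 0 + (\<Sum>x\<in>{..<p} \<times> {..<p} - {(0, 0)}. f (fst x) (snd x))"
    using p_gt_1 by (subst sum.remove[of _ "(0, 0)"]) auto
  also have "(\<Sum>x\<in>{..<p} \<times> {..<p} - {(0, 0)}. f (fst x) (snd x)) = (\<Sum>x\<in>{..<p} \<times> {..<p} - {(0, 0)}. z)"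
  proof (intro sum.cong refl)
    fix x assume "x \<in> {..<p} \<times> {..<p} - {(0, 0)}"
    then show "f (fst x) (snd x) = z" using assms[of "fst x" "snd x"] by (cases x) auto
  qed
  also have "\<dots> = of_nat (p\<^sup>2 - 1) * z"
    using p_gt_1 by (simp add: card_Diff_singleton card_cartesian_product power2_eq_square)
  finally show ?thesis .
qed

text \<open>The \<open>(p - 1)\<close>-tuples with \<open>u\<close> and \<open>v\<close> both equal
  to 1 are counted through the characters \<open>chr i j\<close>. The trivial one contributes
  \<open>card A ^ (p - 1)\<close>, each of the other \<open>p ^ 2 - 1\<close> contributes a norm 1,
  and the total is \<open>p ^ 2\<close> times the count.\<close>

lemma card_power_cong:
  assumes "p > 2"
  shows "p\<^sup>2 dvd card A ^ (p - 1) + (p\<^sup>2 - 1)"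
proof -
  define T where "T = PiE {1..<p} (\<lambda>_. A)"
  define u where "u x = (\<Prod>t\<in>{1..<p}. c1 (x t) ^ t)" for x :: "nat \<Rightarrow> 'a"
  define v where "v x = (\<Prod>t\<in>{1..<p}. c2 (x t) ^ t)" for x :: "nat \<Rightarrow> 'a"
  have fT: "finite T" unfolding T_def using finite_A by (intro finite_PiE) auto
  have root: "(\<Prod>t\<in>{1..<p}. c (x t) ^ t) ^ p = 1" if "x \<in> T" "character G p c" for x c
  proof -
    have "(\<Prod>t\<in>{1..<p}. c (x t) ^ t) ^ p = (\<Prod>t\<in>{1..<p}. (c (x t) ^ p) ^ t)"
      by (simp add: prod_power_distrib mult.commute flip: power_mult)
    also have "\<dots> = 1"
    proof (intro prod.neutral ballI)
      fix t assume "t \<in> {1..<p}"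
      then have "x t \<in> A" using that(1) PiE_mem unfolding T_def by fast
      then show "(c (x t) ^ p) ^ t = 1" using characterD(1)[OF that(2)] A_in by simp
    qed
    finally show ?thesis .
  qed
  have "of_nat (p\<^sup>2 * card {x \<in> T. u x = 1 \<and> v x = 1}) = (\<Sum>i<p. \<Sum>j<p. \<Sum>x\<in>T. u x ^ i * v x ^ j)"
    using root c1 c2 unfolding u_def v_def by (intro card_eq_sum_roots_of_unity2 fT) auto
  also have "\<dots> = (\<Sum>i<p. \<Sum>j<p. \<Prod>t\<in>{1..<p}. chi_sum A (\<lambda>x. chr i j x ^ t))"
  proof (intro sum.cong refl)
    fix i j
    have "u x ^ i * v x ^ j = (\<Prod>t\<in>{1..<p}. chr i j (x t) ^ t) ^ 1" for x
      unfolding u_def v_def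
      by (simp add: prod_power_distrib prod.distrib power_mult_distrib mult.commute flip: power_mult)
    then show "(\<Sum>x\<in>T. u x ^ i * v x ^ j) = (\<Prod>t\<in>{1..<p}. chi_sum A (\<lambda>x. chr i j x ^ t))"
      using chi_sum_norm_expand[OF finite_A, of p "chr i j" 1] p_gt_1 unfolding T_def by simp
  qed
  also have "\<dots> = (\<Prod>t\<in>{1..<p}. chi_sum A (\<lambda>x. chr 0 0 x ^ t)) + of_nat (p\<^sup>2 - 1) * 1"
    using indep norm_chi_sum[OF chr_character p assms] by (intro sum_pair_split) blast
  also have "\<dots> = of_nat (card A ^ (p - 1) + (p\<^sup>2 - 1))" by (simp add: chi_sum_def)
  finally have "p\<^sup>2 * card {x \<in> T. u x = 1 \<and> v x = 1} = card A ^ (p - 1) + (p\<^sup>2 - 1)"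
    by (simp only: of_nat_eq_iff)
  from this[symmetric] show ?thesis by (rule dvdI)
qed

lemma root_mult_eq_1:
  fixes z w :: complex
  assumes "z ^ p = 1" "w ^ p = 1"
  shows "z * w ^ (p - 1) = 1 \<longleftrightarrow> z = w"
proof -
  have "w ^ (p - 1) * w = 1" using assms(2) p_gt_1 by (metis Suc_diff_1 mult.commute power_Suc less_trans zero_less_one)
  then have "w \<noteq> 0" "w ^ (p - 1) = inverse w"
    using inverse_unique[of w "w ^ (p - 1)"] by (auto simp: mult.commute)
  then have "z * w ^ (p - 1) = z / w" by (simp only: divide_inverse)
  then show ?thesis using \<open>w \<noteq> 0\<close> by (simp only: divide_eq_1_iff) auto
qed

text \<open>A Parseval identity: on \<open>p\<close>-th roots of unity the power
  \<open>p - 1\<close> is complex conjugation, so each summand is the squared modulus of a character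
  sum.\<close>

lemma card_class_pairs:
  "of_nat (p\<^sup>2 * card {(x, y) \<in> A \<times> A. c1 x = c1 y \<and> c2 x = c2 y}) =
    (\<Sum>i<p. \<Sum>j<p. chi_sum A (chr i j) * chi_sum A (\<lambda>x. chr i j x ^ (p - 1)))"
proof -
  let ?T = "A \<times> A"
  let ?u = "\<lambda>(x, y). c1 x * c1 y ^ (p - 1)" and ?v = "\<lambda>(x, y). c2 x * c2 y ^ (p - 1)"
  have r: "c1 x ^ p = 1" "c2 x ^ p = 1" if "x \<in> A" for x
    using characterD(1)[OF c1] characterD(1)[OF c2] A_in[OF that] by auto
  have rp: "(z ^ (p - 1)) ^ p = 1" if "z ^ p = 1" for z :: complex
    using that by (metis mult.commute power_mult power_one)
  have "{z \<in> ?T. ?u z = 1 \<and> ?v z = 1} = {(x, y) \<in> A \<times> A. c1 x = c1 y \<and> c2 x = c2 y}"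
    using r by (auto simp: root_mult_eq_1 simp del: One_nat_def)
  moreover have "of_nat (p\<^sup>2 * card {z \<in> ?T. ?u z = 1 \<and> ?v z = 1}) =
      (\<Sum>i<p. \<Sum>j<p. \<Sum>z\<in>?T. ?u z ^ i * ?v z ^ j)"
    using finite_A r rp by (intro card_eq_sum_roots_of_unity2) (auto simp: power_mult_distrib)
  moreover have "(\<Sum>z\<in>?T. ?u z ^ i * ?v z ^ j) = chi_sum A (chr i j) * chi_sum A (\<lambda>x. chr i j x ^ (p - 1))"
    for i j
    unfolding chi_sum_def sum_product sum.cartesian_product
    by (intro sum.cong) (auto simp: power_mult_distrib mult_ac simp flip: power_mult)
  ultimately show ?thesis by simp
qed

text \<open>For \<open>p = 3\<close> the squared modulus of a character sum is its whole norm, and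
  for \<open>p = 2\<close> it is the square of 1 or -1. So every nontrivial summand in
  \<open>card_class_pairs\<close> is 1; for larger \<open>p\<close> the norm has further
  factors.\<close>

lemma card_class_pairs_small:
  assumes "p \<le> 3"
  shows "p\<^sup>2 * card {(x, y) \<in> A \<times> A. c1 x = c1 y \<and> c2 x = c2 y} = (card A)\<^sup>2 + (p\<^sup>2 - 1)"
proof -
  have p23: "p = 2 \<or> p = 3" using assms p_gt_1 by auto
  have one: "chi_sum A (chr i j) * chi_sum A (\<lambda>x. chr i j x ^ (p - 1)) = 1"
    if ij: "i < p" "j < p" "(i, j) \<noteq> (0, 0)" for i j
  proof -
    obtain g where g: "g \<in> carrier G" "chr i j g \<noteq> 1" using indep[OF ij] by blast
    show ?thesis
    proof (cases "p = 2")
      case True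
      have "character G 2 (chr i j)" using chr_character[of i j] by (simp only: True)
      from sum_order2[OF this g] have "chi_sum A (chr i j) * chi_sum A (chr i j) = 1" by (elim disjE) simp_all
      then show ?thesis by (simp add: True)
    next
      case False
      then have p3: "p = 3" using p23 by simp
      have F: "(\<Prod>t\<in>{1..<3}. F t) = F 1 * F 2" for F :: "nat \<Rightarrow> complex"
        by (simp add: eval_nat_numeral)
      have "p > 2" using p3 by simp
      from norm_chi_sum[OF chr_character p this g] show ?thesis unfolding p3 F by simp
    qed
  qed
  have "of_nat (p\<^sup>2 * card {(x, y) \<in> A \<times> A. c1 x = c1 y \<and> c2 x = c2 y}) =
    chi_sum A (chr 0 0) * chi_sum A (\<lambda>x. chr 0 0 x ^ (p - 1)) + of_nat (p\<^sup>2 - 1) * 1"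
    unfolding card_class_pairs using one by (intro sum_pair_split)
  also have "\<dots> = of_nat ((card A)\<^sup>2 + (p\<^sup>2 - 1))" by (simp add: chi_sum_def power2_eq_square)
  finally show ?thesis by (simp only: of_nat_eq_iff)
qed

end

section \<open>The primes 2 and 3\<close>

text \<open>One nonzero integer already exhausts the sum of squares. This is applied to the
  deviations of coset intersections from their typical size.\<close>

lemma indicator_of_sum_squares_eq_1:
  fixes f :: "'v \<Rightarrow> int"
  assumes fin: "finite V" and s1: "(\<Sum>v\<in>V. f v) = 1" and s2: "(\<Sum>v\<in>V. (f v)\<^sup>2) = 1"
  obtains v0 where "v0 \<in> V" "\<And>v. v \<in> V \<Longrightarrow> f v = (if v = v0 then 1 else 0)"
proof -
  have "\<exists>v\<in>V. f v \<noteq> 0" using s1 by (metis sum.neutral zero_neq_one)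
  then obtain v0 where v0: "v0 \<in> V" "f v0 \<noteq> 0" by blast
  have "(f v0)\<^sup>2 > 0" using v0 by simp
  moreover have "(\<Sum>v\<in>V - {v0}. (f v)\<^sup>2) = 1 - (f v0)\<^sup>2"
    using s2 sum.remove[OF fin v0(1), of "\<lambda>v. (f v)\<^sup>2"] by simp
  moreover have "(\<Sum>v\<in>V - {v0}. (f v)\<^sup>2) \<ge> 0" by (rule sum_nonneg) simp
  ultimately have "(\<Sum>v\<in>V - {v0}. (f v)\<^sup>2) = 0" by linarith
  then have z: "f v = 0" if "v \<in> V - {v0}" for v
    using that fin by (subst (asm) sum_nonneg_eq_0_iff) auto
  then have "(\<Sum>v\<in>V - {v0}. f v) = 0" by (intro sum.neutral) auto
  then have "f v0 = 1" using s1 sum.remove[OF fin v0(1), of f] by simp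
  then show ?thesis using that v0(1) z by force
qed

section \<open>Counting products modulo 2 and 3 by orbits\<close>

lemma even_card_involution:
  assumes "finite T" "\<And>x. x \<in> T \<Longrightarrow> f x \<in> T" "\<And>x. x \<in> T \<Longrightarrow> f (f x) = x"
  shows "even (card T) \<longleftrightarrow> even (card {x \<in> T. f x = x})"
  using assms
proof (induction "card T" arbitrary: T rule: less_induct)
  case less
  show ?case
  proof (cases "\<exists>x\<in>T. f x \<noteq> x")
    case False
    then have "{x \<in> T. f x = x} = T" by auto
    then show ?thesis by simp
  next
    case True
    then obtain x where x: "x \<in> T" "f x \<noteq> x" by blast
    let ?T = "T - {x, f x}"
    have sub: "{x, f x} \<subseteq> T" using x less.prems(2) by auto
    have cT: "card T = card ?T + 2"
      using card_Diff_subset[of "{x, f x}" T] sub card_mono[OF less.prems(1) sub] x(2) by simp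
    have "f y \<in> ?T" if "y \<in> ?T" for y
      using that less.prems(2,3) x by (metis Diff_iff insert_iff singleton_iff)
    then have "even (card ?T) \<longleftrightarrow> even (card {x \<in> ?T. f x = x})"
      using less.prems cT by (intro less.hyps) auto
    moreover have "{x \<in> ?T. f x = x} = {x \<in> T. f x = x}"
      using x less.prems(3)[of x] by auto
    ultimately show ?thesis using cT by simp
  qed
qed

lemma card_mod_3_period_3:
  assumes "finite T" "\<And>x. x \<in> T \<Longrightarrow> f x \<in> T" "\<And>x. x \<in> T \<Longrightarrow> f (f (f x)) = x"
  shows "card T mod 3 = card {x \<in> T. f x = x} mod 3"
  using assms
proof (induction "card T" arbitrary: T rule: less_induct)
  case less
  show ?case
  proof (cases "\<exists>x\<in>T. f x \<noteq> x")
    case False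
    then have "{x \<in> T. f x = x} = T" by auto
    then show ?thesis by simp
  next
    case True
    then obtain x where x: "x \<in> T" "f x \<noteq> x" by blast
    have fx: "f x \<in> T" "f (f x) \<in> T" using x less.prems(2) by auto
    have ne: "f (f x) \<noteq> x" "f (f x) \<noteq> f x"
      using x less.prems(3)[OF x(1)] by auto
    let ?T = "T - {x, f x, f (f x)}"
    have sub: "{x, f x, f (f x)} \<subseteq> T" using x fx by auto
    have c3: "card {x, f x, f (f x)} = 3" using x(2) ne by auto
    have cT: "card T = card ?T + 3"
      using card_Diff_subset[of "{x, f x, f (f x)}" T] sub card_mono[OF less.prems(1) sub] c3 by simp
    have "f y \<in> ?T" if y: "y \<in> ?T" for y
    proof -
      have "f (f (f y)) = y" "f (f (f x)) = x" "f y \<in> T" using y x less.prems(2,3) by auto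
      then show ?thesis using y by (metis Diff_iff insert_iff singleton_iff)
    qed
    then have "card ?T mod 3 = card {x \<in> ?T. f x = x} mod 3"
      using less.prems cT by (intro less.hyps) auto
    moreover have "{x \<in> ?T. f x = x} = {x \<in> T. f x = x}"
      using x ne less.prems(3)[of x] by auto
    ultimately show ?thesis using cT by simp
  qed
qed

context near_fact
begin

lemma card_factorizations:
  assumes "h \<in> carrier G"
  shows "card {z \<in> A \<times> B. fst z \<otimes> snd z = h} = (if h = \<one> then 0 else 1)"
proof (cases "h = \<one>")
  case True
  have "fst z \<otimes> snd z \<noteq> \<one>" if "z \<in> A \<times> B" for z
    using bij_betwE[OF bij_mult] that by (auto simp: case_prod_unfold)
  then have "{z \<in> A \<times> B. fst z \<otimes> snd z = h} = {}" using True by auto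
  then show ?thesis using True by (simp only: card.empty simp_thms if_True)
next
  case False
  then have "h \<in> (\<lambda>(a, b). a \<otimes> b) ` (A \<times> B)"
    unfolding bij_betw_imp_surj_on[OF bij_mult] using assms by simp
  then obtain z where z: "z \<in> A \<times> B" "h = fst z \<otimes> snd z"
    unfolding case_prod_unfold by (rule imageE)
  have "{z \<in> A \<times> B. fst z \<otimes> snd z = h} = {z}"
    using z bij_betw_imp_inj_on[OF bij_mult] by (auto simp: inj_on_def case_prod_unfold)
  then show ?thesis using False by simp
qed

text \<open>Given \<open>t\<close>, the remaining two factors are unique, except that
  \<open>f t = g\<close> would require a factorization of the identity, and there is none. Keeping
  all factors in the elements of a Sigma set allows those from \<open>A\<close> to be permuted
  afterwards.\<close>

lemma card_factorizations_Sigma: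
  assumes T: "finite T" "f \<in> T \<rightarrow> carrier G" and g: "g \<in> carrier G"
  shows "card (SIGMA t:T. {z \<in> A \<times> B. f t \<otimes> (fst z \<otimes> snd z) = g}) = card {t \<in> T. f t \<noteq> g}"
proof -
  have c: "card {z \<in> A \<times> B. f t \<otimes> (fst z \<otimes> snd z) = g} = (if f t \<noteq> g then 1 else 0)"
    if t: "t \<in> T" for t
  proof -
    have ft: "f t \<in> carrier G" using T t by auto
    have "{z \<in> A \<times> B. f t \<otimes> (fst z \<otimes> snd z) = g} = {z \<in> A \<times> B. fst z \<otimes> snd z = inv (f t) \<otimes> g}"
      using ft g A_in B_in by (auto simp: m_assoc[symmetric] inv_solve_left)
    moreover have "inv (f t) \<otimes> g = \<one> \<longleftrightarrow> f t = g"
      using ft g by (metis inv_closed inv_equality inv_inv l_inv m_comm)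
    ultimately show ?thesis using card_factorizations[of "inv (f t) \<otimes> g"] ft g by simp
  qed
  have "card (SIGMA t:T. {z \<in> A \<times> B. f t \<otimes> (fst z \<otimes> snd z) = g})
      = (\<Sum>t\<in>T. card {z \<in> A \<times> B. f t \<otimes> (fst z \<otimes> snd z) = g})"
    using T finite_A finite_B by (intro card_SigmaI) auto
  also have "\<dots> = (\<Sum>t\<in>T. if f t \<noteq> g then 1 else 0)" using c by (intro sum.cong) auto
  also have "\<dots> = card {t \<in> T. f t \<noteq> g}" using T by (simp add: sum.If_cases Int_def)
  finally show ?thesis .
qed

text \<open>Exchanging the two factors from \<open>A\<close> in \<open>x\<^sub>1 x\<^sub>2 b = g\<close> leaves the diagonal fixed.\<close>

lemma mem_square_mult:
  assumes g: "g \<in> carrier G" and k: "odd (card A)" and gA: "g \<notin> A"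
  shows "\<exists>x\<in>A. \<exists>b\<in>B. g = x \<otimes> x \<otimes> b"
proof -
  let ?T = "SIGMA x:A. {z \<in> A \<times> B. x \<otimes> (fst z \<otimes> snd z) = g}"
  let ?f = "\<lambda>(x, (y, b)). (y, (x, b))"
  have "card ?T = card {x \<in> A. x \<noteq> g}"
    using card_factorizations_Sigma[OF finite_A _ g, of "\<lambda>x. x"] A_in by auto
  moreover have "{x \<in> A. x \<noteq> g} = A" using gA by auto
  ultimately have "odd (card ?T)" using k by simp
  moreover have "even (card ?T) \<longleftrightarrow> even (card {x \<in> ?T. ?f x = x})"
  proof (rule even_card_involution)
    show "finite ?T" using finite_A finite_B by auto
    show "?f x \<in> ?T" if "x \<in> ?T" for x using that A_in B_in by (auto simp: m_lcomm)
    show "?f (?f x) = x" for x by (cases x) auto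
  qed
  ultimately have "odd (card {x \<in> ?T. ?f x = x})" by simp
  then have "{x \<in> ?T. ?f x = x} \<noteq> {}" by (metis card.empty even_zero)
  then show ?thesis using A_in B_in by (force simp: m_assoc)
qed

text \<open>The cardinality is the number of solutions of \<open>x y z b = g\<close> with
  \<open>x\<close>, \<open>y\<close>, \<open>z\<close> in \<open>A\<close>, because \<open>x\<close>
  and \<open>y\<close> determine the rest unless \<open>x y = g\<close>. Rotating \<open>x\<close>,
  \<open>y\<close>, \<open>z\<close> cyclically would fix only solutions with
  \<open>x = y = z\<close>, which \<open>n\<close> excludes.\<close>

lemma card_pairs_mod_3:
  assumes g: "g \<in> carrier G" and n: "\<And>x b. x \<in> A \<Longrightarrow> b \<in> B \<Longrightarrow> g \<noteq> x \<otimes> x \<otimes> x \<otimes> b"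
  shows "card {z \<in> A \<times> A. fst z \<otimes> snd z \<noteq> g} mod 3 = 0"
proof -
  let ?T = "SIGMA t:A \<times> A. {z \<in> A \<times> B. (fst t \<otimes> snd t) \<otimes> (fst z \<otimes> snd z) = g}"
  let ?f = "\<lambda>((x, y), (z, b)). ((y, z), (x, b))"
  have cT: "card ?T = card {z \<in> A \<times> A. fst z \<otimes> snd z \<noteq> g}"
    using finite_A A_in by (intro card_factorizations_Sigma g) auto
  have fT: "card ?T mod 3 = card {x \<in> ?T. ?f x = x} mod 3"
  proof (rule card_mod_3_period_3)
    show "finite ?T" using finite_A finite_B by auto
    show "?f x \<in> ?T" if "x \<in> ?T" for x using that A_in B_in by (auto simp: m_ac)
    show "?f (?f (?f x)) = x" for x by (cases x) auto
  qed
  have "x \<otimes> x \<otimes> (x \<otimes> b) \<noteq> g" if "x \<in> A" "b \<in> B" for x b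
    using n[OF that] A_in B_in that by (simp add: m_assoc)
  then have "{x \<in> ?T. ?f x = x} = {}" by auto
  with fT show ?thesis by (simp only: cT card.empty mod_0)
qed

lemma even_card_square_roots:
  assumes "\<And>x. x \<in> A \<Longrightarrow> g \<noteq> x \<otimes> x"
  shows "even (card {z \<in> A \<times> A. fst z \<otimes> snd z = g})"
proof -
  let ?T = "{z \<in> A \<times> A. fst z \<otimes> snd z = g}"
  have "even (card ?T) \<longleftrightarrow> even (card {x \<in> ?T. prod.swap x = x})"
  proof (rule even_card_involution)
    show "finite ?T" using finite_A by auto
    show "prod.swap x \<in> ?T" if "x \<in> ?T" for x using that A_in by (auto simp: m_comm)
  qed auto
  moreover have "{x \<in> ?T. prod.swap x = x} = {}" using assms by auto
  ultimately show ?thesis by (metis card.empty even_zero)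
qed

end

section \<open>Distribution of the two factors over the cosets of the common kernel\<close>

context near_fact_pair
begin

text \<open>The pair of values labels a coset of the common kernel of \<open>c1\<close> and
  \<open>c2\<close>. \<open>R\<close> is the set of all \<open>p ^ 2\<close> labels, each of which
  occurs by \<open>card_class\<close>, and \<open>dual\<close> gives the label of the inverse
  coset.\<close>

definition cls where "cls x = (c1 x, c2 x)"
definition R where "R = {z::complex. z ^ p = 1} \<times> {z::complex. z ^ p = 1}"
definition dual where "dual v = (inverse (fst v), inverse (snd v))" for v :: "complex \<times> complex"

lemma finite_R: "finite R" unfolding R_def using p_gt_1 by (intro finite_cartesian_product finite_roots_unity) auto

lemma card_R: "card R = p\<^sup>2"
  unfolding R_def using p_gt_1 by (simp add: card_cartesian_product card_roots_unity_eq power2_eq_square)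

lemma cls_in_R: "x \<in> carrier G \<Longrightarrow> cls x \<in> R"
  unfolding R_def cls_def using characterD(1)[OF c1] characterD(1)[OF c2] by auto

lemma dual_in_R: "v \<in> R \<Longrightarrow> dual v \<in> R"
  unfolding R_def dual_def by (auto simp: power_inverse)

lemma dual_dual: "dual (dual v) = v" by (simp add: dual_def)

lemma R_nonzero: "v \<in> R \<Longrightarrow> fst v \<noteq> 0 \<and> snd v \<noteq> 0"
  unfolding R_def using p_gt_1 by (auto simp: zero_power)

lemma cls_mult: "x \<in> carrier G \<Longrightarrow> y \<in> carrier G \<Longrightarrow> cls (x \<otimes> y) = (c1 x * c1 y, c2 x * c2 y)"
  unfolding cls_def using characterD(2)[OF c1] characterD(2)[OF c2] by auto

lemma cls_one: "cls \<one> = (1, 1)"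
  unfolding cls_def using character_one c1 c2 p_gt_1 by auto

text \<open>When the indicator of the class is expanded in the characters \<open>chr i j\<close>,
  only the trivial one has a nonzero sum over the group.\<close>

lemma card_class: assumes v: "v \<in> R"
  shows "p\<^sup>2 * card {x \<in> carrier G. cls x = v} = order G"
proof -
  let ?u = "\<lambda>x. c1 x * inverse (fst v)" and ?w = "\<lambda>x. c2 x * inverse (snd v)"
  have "{x \<in> carrier G. cls x = v} = {x \<in> carrier G. ?u x = 1 \<and> ?w x = 1}"
    using R_nonzero[OF v] by (cases v) (auto simp: cls_def field_simps)
  moreover have "of_nat (p\<^sup>2 * card {x \<in> carrier G. ?u x = 1 \<and> ?w x = 1}) =
    (\<Sum>i<p. \<Sum>j<p. \<Sum>x\<in>carrier G. ?u x ^ i * ?w x ^ j)"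
    using characterD(1)[OF c1] characterD(1)[OF c2] v
    by (intro card_eq_sum_roots_of_unity2 fin) (auto simp: R_def power_mult_distrib power_inverse)
  moreover have "(\<Sum>x\<in>carrier G. ?u x ^ i * ?w x ^ j) =
      (inverse (fst v) ^ i * inverse (snd v) ^ j) * (\<Sum>x\<in>carrier G. chr i j x)" for i j
    by (simp add: sum_distrib_left power_mult_distrib mult_ac)
  moreover have "(inverse (fst v) ^ i * inverse (snd v) ^ j) * (\<Sum>x\<in>carrier G. chr i j x) = 0"
    if "i < p" "j < p" "(i, j) \<noteq> (0, 0)" for i j
  proof -
    from indep[OF that] have "(\<Sum>x\<in>carrier G. chr i j x) = 0"
      using sum_character_carrier[OF chr_character] by blast
    then show ?thesis by simp
  qed
  then have "(\<Sum>i<p. \<Sum>j<p. (inverse (fst v) ^ i * inverse (snd v) ^ j) * (\<Sum>x\<in>carrier G. chr i j x)) =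
    (inverse (fst v) ^ 0 * inverse (snd v) ^ 0) * (\<Sum>x\<in>carrier G. chr 0 0 x) + of_nat (p\<^sup>2 - 1) * 0"
    by (rule sum_pair_split)
  ultimately have "of_nat (p\<^sup>2 * card {x \<in> carrier G. cls x = v}) =
    (inverse (fst v) ^ 0 * inverse (snd v) ^ 0) * (\<Sum>x\<in>carrier G. chr 0 0 x) + of_nat (p\<^sup>2 - 1) * (0::complex)"
    by (simp only:)
  also have "\<dots> = of_nat (order G)" by (simp add: order_def)
  finally show ?thesis by (simp only: of_nat_eq_iff)
qed

lemma sum_card_classes:
  assumes "Y \<subseteq> carrier G"
  shows "(\<Sum>v\<in>R. card {x \<in> Y. cls x = v}) = card Y"
proof -
  have "finite Y" by (rule finite_subset[OF assms fin])
  from sum.group[OF this finite_R, of cls "\<lambda>_. 1::nat"] show ?thesis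
    using assms cls_in_R by auto
qed

lemma sum_card_classes_sq:
  assumes "Y \<subseteq> carrier G"
  shows "(\<Sum>v\<in>R. (card {x \<in> Y. cls x = v})\<^sup>2) = card {(x, y) \<in> Y \<times> Y. c1 x = c1 y \<and> c2 x = c2 y}"
proof -
  have fY: "finite Y" by (rule finite_subset[OF assms fin])
  have "(\<Sum>v\<in>R. (card {x \<in> Y. cls x = v})\<^sup>2) =
      (\<Sum>v\<in>R. card ({x \<in> Y. cls x = v} \<times> {x \<in> Y. cls x = v}))"
    by (simp add: card_cartesian_product power2_eq_square)
  also have "\<dots> = card (\<Union>v\<in>R. {x \<in> Y. cls x = v} \<times> {x \<in> Y. cls x = v})"
    using fY finite_R by (intro card_UN_disjoint[symmetric]) auto
  also have "(\<Union>v\<in>R. {x \<in> Y. cls x = v} \<times> {x \<in> Y. cls x = v}) =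
      {(x, y) \<in> Y \<times> Y. c1 x = c1 y \<and> c2 x = c2 y}"
    using assms cls_in_R by (auto simp: cls_def)
  finally show ?thesis .
qed

text \<open>The integers \<open>s\<close> times (class size minus \<open>q\<close>) sum to 1 by the
  size of \<open>A\<close>, and their squares sum to 1 by \<open>card_class_pairs_small\<close>; so
  one of them is 1 and the others vanish. The sign \<open>s\<close> covers both factors, one being 1
  and the other -1 modulo \<open>p ^ 2\<close>.\<close>

lemma class_sizes:
  fixes q s :: int
  assumes p3: "p \<le> 3" and s: "s = 1 \<or> s = -1" and k: "int (card A) = int (p\<^sup>2) * q + s"
  obtains v0 where "v0 \<in> R"
    "\<And>v. v \<in> R \<Longrightarrow> int (card {x \<in> A. cls x = v}) = q + s * (if v = v0 then 1 else 0)"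
proof -
  let ?a = "\<lambda>v. int (card {x \<in> A. cls x = v})"
  let ?P = "int (p\<^sup>2)"
  let ?f = "\<lambda>v. s * (?a v - q)"
  have ss: "s * s = 1" using s by auto
  have P1: "p\<^sup>2 \<ge> 1" using p_gt_1 by simp
  have sa: "(\<Sum>v\<in>R. ?a v) = int (card A)"
    using sum_card_classes[OF A_carrier] by (simp flip: of_nat_sum)
  have "?P * (\<Sum>v\<in>R. (?a v)\<^sup>2) = (int (card A))\<^sup>2 + (?P - 1)"
  proof -
    have "p\<^sup>2 * (\<Sum>v\<in>R. (card {x \<in> A. cls x = v})\<^sup>2) = (card A)\<^sup>2 + (p\<^sup>2 - 1)"
      using card_class_pairs_small[OF p3] sum_card_classes_sq[OF A_carrier] by simp
    then have "int (p\<^sup>2 * (\<Sum>v\<in>R. (card {x \<in> A. cls x = v})\<^sup>2)) = int ((card A)\<^sup>2 + (p\<^sup>2 - 1))" by simp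
    then show ?thesis using P1 by (simp add: of_nat_diff)
  qed
  then have sa2: "?P * (\<Sum>v\<in>R. (?a v)\<^sup>2) = (?P * q + s)\<^sup>2 + (?P - 1)" by (simp only: k)
  have s1: "(\<Sum>v\<in>R. ?f v) = 1"
  proof -
    have "(\<Sum>v\<in>R. ?f v) = s * ((\<Sum>v\<in>R. ?a v) - ?P * q)"
      by (simp add: sum_distrib_left[symmetric] sum_subtractf card_R)
    also have "\<dots> = s * s" unfolding sa k by simp
    finally show ?thesis using ss by simp
  qed
  have s2: "(\<Sum>v\<in>R. (?f v)\<^sup>2) = 1"
  proof -
    have e: "(?f v)\<^sup>2 = (?a v)\<^sup>2 - 2 * q * ?a v + q\<^sup>2" for v
      using s by (auto simp: power2_eq_square algebra_simps)
    have "(\<Sum>v\<in>R. (?f v)\<^sup>2) = (\<Sum>v\<in>R. (?a v)\<^sup>2) - 2 * q * (\<Sum>v\<in>R. ?a v) + ?P * q\<^sup>2"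
      unfolding e by (simp add: sum.distrib sum_subtractf sum_distrib_left[symmetric] card_R)
    then have "(\<Sum>v\<in>R. (?f v)\<^sup>2) = (\<Sum>v\<in>R. (?a v)\<^sup>2) - 2 * q * (?P * q + s) + ?P * q\<^sup>2"
      by (simp only: sa k)
    then have "?P * (\<Sum>v\<in>R. (?f v)\<^sup>2) =
        ?P * (\<Sum>v\<in>R. (?a v)\<^sup>2) - ?P * (2 * q * (?P * q + s)) + ?P * (?P * q\<^sup>2)"
      by (simp only: right_diff_distrib distrib_left)
    also have "\<dots> = (?P * q + s)\<^sup>2 + (?P - 1) - ?P * (2 * q * (?P * q + s)) + ?P * (?P * q\<^sup>2)"
      by (simp only: sa2)
    also have "\<dots> = ?P * 1" using ss by (simp add: power2_eq_square algebra_simps)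
    finally show ?thesis using p_gt_1 by (simp only: mult_cancel_left) simp
  qed
  obtain v0 where v0: "v0 \<in> R" "\<And>v. v \<in> R \<Longrightarrow> ?f v = (if v = v0 then 1 else 0)"
  proof (rule indicator_of_sum_squares_eq_1[OF finite_R s1 s2])
    fix v0
    assume "v0 \<in> R" "\<And>v. v \<in> R \<Longrightarrow> ?f v = (if v = v0 then 1 else 0)"
    then show thesis by (rule that)
  qed
  have "?a v = q + s * (if v = v0 then 1 else 0)" if "v \<in> R" for v
  proof -
    have "s * ?f v = ?a v - q" using ss by (simp flip: mult.assoc)
    then show ?thesis using v0(2)[OF that] by (simp split: if_splits)
  qed
  with v0(1) show ?thesis by (rule that)
qed

text \<open>The exceptional classes \<open>v0\<close> of \<open>A\<close> and \<open>w0\<close> of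
  \<open>B\<close> are matched by counting pairs with product in the common kernel. There are
  \<open>card ?N - 1\<close> of them, as the identity is missed; summing over \<open>A\<close> gives
  \<open>card A * q' - q\<close>, less 1 exactly if \<open>dual w0 = v0\<close>. Since
  \<open>card ?N = card A * q' - q\<close>, the correction must be there.\<close>

lemma dual_class_sizes:
  fixes q q' :: int
  assumes p3: "p \<le> 3" and k: "int (card A) = int (p\<^sup>2) * q + 1" and k': "int (card B) = int (p\<^sup>2) * q' - 1"
  obtains v0 where "v0 \<in> R"
    "\<And>v. v \<in> R \<Longrightarrow> int (card {x \<in> A. cls x = v}) = q + (if v = v0 then 1 else 0)"
    "\<And>v. v \<in> R \<Longrightarrow> int (card {x \<in> B. cls x = v}) = q' - (if v = dual v0 then 1 else 0)"
proof -
  interpret BA: near_fact_pair G B A p c1 c2 by (rule near_fact_pair_swap)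
  obtain v0 where v0: "v0 \<in> R"
    "\<And>v. v \<in> R \<Longrightarrow> int (card {x \<in> A. cls x = v}) = q + 1 * (if v = v0 then 1 else 0)"
    using class_sizes[OF p3 _ k] by blast
  obtain w0 where w0: "w0 \<in> R"
    "\<And>v. v \<in> R \<Longrightarrow> int (card {x \<in> B. cls x = v}) = q' + (-1) * (if v = w0 then 1 else 0)"
    using BA.class_sizes[OF p3, of "-1" q'] k' by auto
  let ?P = "int (p\<^sup>2)"
  let ?N = "{g \<in> carrier G. cls g = (1, 1)}"
  let ?Q = "{z \<in> A \<times> B. cls (fst z \<otimes> snd z) = (1, 1)}"
  have "(1, 1) \<in> R" by (simp add: R_def)
  from card_class[OF this] have "p\<^sup>2 * card ?N = card A * card B + 1" using card_eq by (simp only:)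
  then have "int (p\<^sup>2 * card ?N) = int (card A * card B + 1)" by (simp only:)
  then have m: "?P * int (card ?N) = int (card A) * int (card B) + 1" by simp
  have "card ?Q = card (?N - {\<one>})"
  proof (rule bij_betw_same_card)
    have "(\<lambda>(a, b). a \<otimes> b) ` ?Q = ?N - {\<one>}"
    proof -
      have "(\<lambda>(a, b). a \<otimes> b) ` ?Q = (\<lambda>(a, b). a \<otimes> b) ` (A \<times> B) \<inter> {g. cls g = (1, 1)}" by auto
      then show ?thesis using bij_betw_imp_surj_on[OF bij_mult] by auto
    qed
    moreover have "inj_on (\<lambda>(a, b). a \<otimes> b) ?Q"
      by (rule inj_on_subset[OF bij_betw_imp_inj_on[OF bij_mult]]) auto
    ultimately show "bij_betw (\<lambda>(a, b). a \<otimes> b) ?Q (?N - {\<one>})" by (simp add: bij_betw_def)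
  qed
  also have "\<dots> = card ?N - 1" using cls_one by (simp add: card_Diff_singleton)
  finally have cQ: "card ?Q = card ?N - 1" .
  have "\<one> \<in> ?N" using cls_one by simp
  moreover have "finite ?N" using fin by simp
  ultimately have "card ?N > 0" using card_gt_0_iff by blast
  then have cQ': "int (card ?Q) = int (card ?N) - 1" using cQ by simp
  have "?Q = (SIGMA x:A. {b \<in> B. cls b = dual (cls x)})"
  proof -
    have "cls (x \<otimes> b) = (1, 1) \<longleftrightarrow> cls b = dual (cls x)" if "x \<in> A" "b \<in> B" for x b
    proof -
      have x: "x \<in> carrier G" and b: "b \<in> carrier G" using that A_in B_in by auto
      have "c1 x \<noteq> 0" "c2 x \<noteq> 0" using R_nonzero[OF cls_in_R[OF x]] by (auto simp: cls_def)
      then show ?thesis unfolding cls_mult[OF x b] by (auto simp: cls_def dual_def field_simps)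
    qed
    then show ?thesis by auto
  qed
  then have "card ?Q = (\<Sum>x\<in>A. card {b \<in> B. cls b = dual (cls x)})"
    using finite_A finite_B by simp
  then have "int (card ?Q) = (\<Sum>x\<in>A. int (card {b \<in> B. cls b = dual (cls x)}))" by simp
  also have "\<dots> = (\<Sum>x\<in>A. q' - (if cls x = dual w0 then 1 else 0))"
  proof (intro sum.cong refl)
    fix x assume "x \<in> A"
    then have "dual (cls x) \<in> R" using cls_in_R dual_in_R A_in by blast
    moreover have "dual (cls x) = w0 \<longleftrightarrow> cls x = dual w0" using dual_dual by metis
    ultimately show "int (card {b \<in> B. cls b = dual (cls x)}) = q' - (if cls x = dual w0 then 1 else 0)"
      using w0(2) by simp
  qed
  also have "\<dots> = int (card A) * q' - int (card {x \<in> A. cls x = dual w0})"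
    using finite_A by (simp add: sum_subtractf sum.If_cases Int_def)
  also have "int (card {x \<in> A. cls x = dual w0}) = q + (if dual w0 = v0 then 1 else 0)"
    using v0(2)[OF dual_in_R[OF w0(1)]] by simp
  finally have "int (card ?N) = int (card A) * q' - q - (if dual w0 = v0 then 1 else 0) + 1" using cQ' by simp
  then have "(int (card A) * int (card B) + 1) = ?P * (int (card A) * q' - q - (if dual w0 = v0 then 1 else 0) + 1)"
    using m by simp
  moreover have "int (card A) * int (card B) + 1 = ?P * (int (card A) * q' - q)"
    unfolding k k' by (simp add: algebra_simps)
  ultimately have "?P * (int (card A) * q' - q) = ?P * (int (card A) * q' - q - (if dual w0 = v0 then 1 else 0) + 1)"
    by simp
  moreover have "?P \<noteq> 0" using p_gt_1 by simp
  ultimately have "dual w0 = v0" by (simp split: if_splits)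
  then have "w0 = dual v0" using dual_dual by metis
  then show ?thesis using that[of v0] v0 w0(2) by simp
qed

end

section \<open>Residues of the two sizes and the contradictions for 2 and 3\<close>

lemma mod_mult_add_1_eq_0:
  fixes a b m :: nat
  assumes "m dvd a * b + 1"
  shows "((a mod m) * (b mod m) + 1) mod m = 0"
proof -
  have "((a mod m) * (b mod m) + 1) mod m = (a * b + 1) mod m"
    by (metis mod_add_left_eq mod_mult_eq)
  then show ?thesis using assms by (simp only: dvd_eq_mod_eq_0)
qed

lemma residues_mod_4:
  fixes a b :: nat
  assumes "(a * b + 1) mod 4 = 0" "a < 4" "b < 4"
  shows "a = 1 \<and> b = 3 \<or> a = 3 \<and> b = 1"
proof -
  have "a = 0 \<or> a = 1 \<or> a = 2 \<or> a = 3" using assms(2) by linarith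
  then show ?thesis using assms(1,3) by (elim disjE; hypsubst; presburger)
qed

lemma residues_mod_9:
  fixes a b :: nat
  assumes "a\<^sup>2 mod 9 = 1" "(a * b + 1) mod 9 = 0" "a < 9" "b < 9"
  shows "a = 1 \<and> b = 8 \<or> a = 8 \<and> b = 1"
proof -
  have "a = 0 \<or> a = 1 \<or> a = 2 \<or> a = 3 \<or> a = 4 \<or> a = 5 \<or> a = 6 \<or> a = 7 \<or> a = 8"
    using assms(3) by linarith
  then have "a = 1 \<or> a = 8" using assms(1) by (elim disjE) simp_all
  then show ?thesis using assms(2,4) by (elim disjE; hypsubst; presburger)
qed

context near_fact_pair
begin

lemma sq_dvd_order: "p\<^sup>2 dvd card A * card B + 1"
proof -
  have "(1, 1) \<in> R" by (simp add: R_def)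
  from card_class[OF this] have "p\<^sup>2 dvd order G" by (metis dvd_triv_left)
  then show ?thesis by (simp only: card_eq)
qed

lemma R_powers: "v \<in> R \<Longrightarrow> fst v ^ p = 1 \<and> snd v ^ p = 1"
  by (auto simp: R_def)

lemma cls_power_mult:
  assumes "x \<in> carrier G" "b \<in> carrier G"
  shows "p = 2 \<Longrightarrow> cls (x \<otimes> x \<otimes> b) = cls b" and "p = 3 \<Longrightarrow> cls (x \<otimes> x \<otimes> x \<otimes> b) = cls b"
  using assms characterD[OF c1, of x] characterD[OF c2, of x] characterD(2)[OF c1] characterD(2)[OF c2]
  by (simp_all add: cls_def power2_eq_square power3_eq_cube)

text \<open>Every \<open>g\<close> in the class \<open>v0\<close> lies in \<open>A\<close> or is
  \<open>x x b\<close>, where \<open>b\<close> has class \<open>v0\<close> because squares lie in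
  the common kernel. The class has \<open>4 q q' - q + q'\<close> elements, but this covers at most
  \<open>(q + 1) + (4 q + 1) (q' - 1) = 4 q q' - 3 q + q'\<close>.\<close>

lemma near_fact_order_2:
  assumes p2: "p = 2" and k: "card A = 4 * q + 1" and k': "card B + 1 = 4 * q'" and q: "q > 0"
  shows False
proof -
  obtain v0 where v0: "v0 \<in> R"
    "\<And>v. v \<in> R \<Longrightarrow> int (card {x \<in> A. cls x = v}) = int q + (if v = v0 then 1 else 0)"
    "\<And>v. v \<in> R \<Longrightarrow> int (card {x \<in> B. cls x = v}) = int q' - (if v = dual v0 then 1 else 0)"
  proof (rule dual_class_sizes)
    show "p \<le> 3" using p2 by simp
    show "int (card A) = int (p\<^sup>2) * int q + 1" using k p2 by simp
    show "int (card B) = int (p\<^sup>2) * int q' - 1" using k' p2 by simp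
  next
    fix v0
    assume "v0 \<in> R"
      "\<And>v. v \<in> R \<Longrightarrow> int (card {x \<in> A. cls x = v}) = int q + (if v = v0 then 1 else 0)"
      "\<And>v. v \<in> R \<Longrightarrow> int (card {x \<in> B. cls x = v}) = int q' - (if v = dual v0 then 1 else 0)"
    then show thesis by (rule that)
  qed
  \<comment> \<open>For \<open>p = 2\<close> labels are pairs of signs, so the exceptional classes
    of \<open>A\<close> and \<open>B\<close> coincide.\<close>
  have d: "dual v0 = v0"
    using R_powers[OF v0(1)] unfolding p2 by (cases v0) (auto simp: dual_def power2_eq_1_iff)
  let ?D = "{g \<in> carrier G. cls g = v0}" and ?A0 = "{x \<in> A. cls x = v0}" and ?B0 = "{b \<in> B. cls b = v0}"
  let ?E = "(\<lambda>(x, b). x \<otimes> x \<otimes> b) ` (A \<times> ?B0)"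
  have "?D \<subseteq> ?A0 \<union> ?E"
  proof
    fix g assume g: "g \<in> ?D"
    show "g \<in> ?A0 \<union> ?E"
    proof (cases "g \<in> A")
      case False
      then obtain x b where xb: "x \<in> A" "b \<in> B" "g = x \<otimes> x \<otimes> b"
        using mem_square_mult[of g] g k by auto
      then have "cls b = v0" using g cls_power_mult(1)[OF _ _ p2] A_in B_in by auto
      then show ?thesis using xb by auto
    qed (use g in auto)
  qed
  then have "card ?D \<le> card (?A0 \<union> ?E)" using finite_A finite_B by (intro card_mono) auto
  also have "\<dots> \<le> card ?A0 + card ?E" by (rule card_Un_le)
  also have "card ?E \<le> card A * card ?B0"
    using card_image_le[of "A \<times> ?B0" "\<lambda>(x, b). x \<otimes> x \<otimes> b"] finite_A finite_B
    by (simp add: card_cartesian_product)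
  finally have "card ?D \<le> card ?A0 + card A * card ?B0" by simp
  then have "int (card ?D) \<le> int (card ?A0 + card A * card ?B0)" by (simp only: of_nat_le_iff)
  then have "int (card ?D) \<le> int (card ?A0) + int (card A) * int (card ?B0)" by simp
  then have "int (card ?D) \<le> int q + 1 + (4 * int q + 1) * (int q' - 1)"
  proof -
    have "int (card A) = 4 * int q + 1" "int (card ?A0) = int q + 1" "int (card ?B0) = int q' - 1"
      using v0(2,3)[OF v0(1)] d k by simp_all
    with \<open>int (card ?D) \<le> int (card ?A0) + int (card A) * int (card ?B0)\<close>
    show ?thesis by (simp only:)
  qed
  moreover have "4 * int (card ?D) = (4 * int q + 1) * (4 * int q' - 1) + 1"
  proof -
    have "4 * card ?D = card A * card B + 1" using card_class[OF v0(1)] card_eq p2 by simp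
    then have "int (4 * card ?D) = int (card A * card B + 1)" by (simp only:)
    then have "4 * int (card ?D) = int (card A) * int (card B) + 1" by simp
    moreover have "int (card A) = 4 * int q + 1" "int (card B) = 4 * int q' - 1" using k k' by linarith+
    ultimately show ?thesis by simp
  qed
  ultimately show False using q by (simp add: algebra_simps)
qed

text \<open>In the class of \<open>dual v0\<close> at least \<open>8 q + 1\<close> elements, forming
  \<open>?U\<close>, are not of the form \<open>x x x b\<close>. Each of them is a product of two
  elements of \<open>A\<close> in \<open>r g\<close> ways with \<open>r g\<close> congruent to 1
  modulo 3, and in at least 4 ways unless it is one of at most \<open>q + 1\<close> squares. This is
  more than the number of available pairs.\<close>

lemma near_fact_order_3:
  assumes p3: "p = 3" and k: "card A = 9 * q + 1" and k': "card B + 1 = 9 * q'" and q: "q > 0" "q \<le> 2"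
  shows False
proof -
  obtain v0 where v0: "v0 \<in> R"
    "\<And>v. v \<in> R \<Longrightarrow> int (card {x \<in> A. cls x = v}) = int q + (if v = v0 then 1 else 0)"
    "\<And>v. v \<in> R \<Longrightarrow> int (card {x \<in> B. cls x = v}) = int q' - (if v = dual v0 then 1 else 0)"
  proof (rule dual_class_sizes)
    show "p \<le> 3" using p3 by simp
    show "int (card A) = int (p\<^sup>2) * int q + 1" using k p3 by simp
    show "int (card B) = int (p\<^sup>2) * int q' - 1" using k' p3 by simp
  next
    fix v0
    assume "v0 \<in> R"
      "\<And>v. v \<in> R \<Longrightarrow> int (card {x \<in> A. cls x = v}) = int q + (if v = v0 then 1 else 0)"
      "\<And>v. v \<in> R \<Longrightarrow> int (card {x \<in> B. cls x = v}) = int q' - (if v = dual v0 then 1 else 0)"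
    then show thesis by (rule that)
  qed
  have v03: "fst v0 ^ 3 = 1" "snd v0 ^ 3 = 1" using R_powers[OF v0(1)] unfolding p3 by auto
  \<comment> \<open>Squaring inverts cube roots of unity, so \<open>x \<otimes> x\<close> has class
    \<open>dual v0\<close> only if \<open>x\<close> has class \<open>v0\<close>.\<close>
  have root3: "z * z = inverse w \<longleftrightarrow> z = w" if "z ^ 3 = 1" "w ^ 3 = 1" for z w :: complex
  proof
    have w0: "w \<noteq> 0" "z \<noteq> 0" using that by auto
    {
      assume "z * z = inverse w"
      then have "z * z * w = 1" using w0 by (simp add: field_simps)
      then have "z * z * w = z * z * z" using that(1) by (simp add: power3_eq_cube)
      then show "z = w" using w0 by simp
    }
    {
      assume "z = w"
      then show "z * z = inverse w" using that w0 by (simp add: power3_eq_cube field_simps)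
    }
  qed
  let ?w = "dual v0"
  have wR: "?w \<in> R" using dual_in_R v0(1) by blast
  let ?D = "{g \<in> carrier G. cls g = ?w}" and ?A0 = "{x \<in> A. cls x = v0}" and ?B0 = "{b \<in> B. cls b = ?w}"
  let ?E = "(\<lambda>(x, b). x \<otimes> x \<otimes> x \<otimes> b) ` (A \<times> ?B0)"
  let ?S = "(\<lambda>x. x \<otimes> x) ` ?A0"
  let ?U = "?D - ?E"
  define r where "r g = card {z \<in> A \<times> A. fst z \<otimes> snd z = g}" for g
  have finD: "finite ?D" using fin by simp
  have kk: "int (card A) = 9 * int q + 1" "int (card B) = 9 * int q' - 1" using k k' by linarith+
  have cD: "int (card ?D) = 9 * int q * int q' - int q + int q'"
  proof -
    have "9 * card ?D = card A * card B + 1" using card_class[OF wR] card_eq p3 by simp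
    then have "int (9 * card ?D) = int (card A * card B + 1)" by (simp only:)
    then have "9 * int (card ?D) = int (card A) * int (card B) + 1" by simp
    then show ?thesis unfolding kk by (simp add: algebra_simps)
  qed
  have "card ?E \<le> card A * card ?B0"
    using card_image_le[of "A \<times> ?B0" "\<lambda>(x, b). x \<otimes> x \<otimes> x \<otimes> b"] finite_A finite_B
    by (simp add: card_cartesian_product)
  then have "int (card ?E) \<le> int (card A) * int (card ?B0)" by (simp flip: of_nat_mult)
  also have "\<dots> = (9 * int q + 1) * (int q' - 1)" using v0(3)[OF wR] kk by simp
  finally have cE: "int (card ?E) \<le> (9 * int q + 1) * (int q' - 1)" .
  have "card ?D - card ?E \<le> card ?U" using finite_A finite_B by (intro diff_card_le_card_Diff) auto
  then have "int (card ?D) - int (card ?E) \<le> int (card ?U)" by linarith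
  then have cU: "8 * int q + 1 \<le> int (card ?U)" using cD cE by (simp add: algebra_simps)
  have r1: "r g mod 3 = 1" if g: "g \<in> ?U" for g
  proof -
    have "g \<noteq> x \<otimes> x \<otimes> x \<otimes> b" if "x \<in> A" "b \<in> B" for x b
    proof
      assume e: "g = x \<otimes> x \<otimes> x \<otimes> b"
      then have "cls b = ?w" using g cls_power_mult(2)[OF _ _ p3, of x b] A_in B_in that by auto
      then have "g \<in> ?E" using that e by auto
      then show False using g by blast
    qed
    then have m: "card {z \<in> A \<times> A. fst z \<otimes> snd z \<noteq> g} mod 3 = 0"
      using card_pairs_mod_3[of g] g by blast
    have "card (A \<times> A) = card ({z \<in> A \<times> A. fst z \<otimes> snd z = g} \<union> {z \<in> A \<times> A. fst z \<otimes> snd z \<noteq> g})"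
      by (rule arg_cong[of _ _ card]) auto
    also have "\<dots> = r g + card {z \<in> A \<times> A. fst z \<otimes> snd z \<noteq> g}"
      unfolding r_def using finite_A by (intro card_Un_disjoint) auto
    finally have "card A * card A = r g + card {z \<in> A \<times> A. fst z \<otimes> snd z \<noteq> g}"
      by (simp add: card_cartesian_product)
    moreover have "(card A * card A) mod 3 = 1"
    proof -
      have "card A mod 3 = 1" unfolding k by presburger
      then show ?thesis by (metis mod_mult_eq mult_1 numeral_One mod_less one_less_numeral_iff semiring_norm(77))
    qed
    ultimately show ?thesis using m by presburger
  qed
  \<comment> \<open>Without a square root of \<open>g\<close> in \<open>A\<close>, exchanging the
    factors makes \<open>r g\<close> even; the least even number congruent to 1 modulo 3 is
    4.\<close>
  have r4: "r g \<ge> 4" if g: "g \<in> ?U - ?S" for g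
  proof -
    have "g \<noteq> x \<otimes> x" if x: "x \<in> A" for x
    proof
      assume e: "g = x \<otimes> x"
      have xG: "x \<in> carrier G" using x A_in by blast
      have "c1 x ^ 3 = 1" "c2 x ^ 3 = 1" using characterD(1)[OF c1 xG] characterD(1)[OF c2 xG] p3 by auto
      moreover have "c1 x * c1 x = inverse (fst v0)" "c2 x * c2 x = inverse (snd v0)"
        using g cls_mult[OF xG xG] unfolding e by (auto simp: dual_def)
      ultimately have "cls x = v0" using root3 v03 by (auto simp: cls_def prod_eq_iff)
      then show False using g x e by blast
    qed
    then have "even (r g)" unfolding r_def by (rule even_card_square_roots)
    moreover have "r g mod 3 = 1" using r1 g by blast
    ultimately show ?thesis by presburger
  qed
  \<comment> \<open>For each \<open>x\<close> in \<open>A\<close> the class of the second factor is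
    prescribed. It contains \<open>q\<close> elements of \<open>A\<close>, and one more exactly if
    \<open>x\<close> itself has class \<open>v0\<close>.\<close>
  have "int (\<Sum>g\<in>?D. r g) = int (card A) * int q + int q + 1"
  proof -
    have "(\<Sum>g\<in>?D. r g) = card {z \<in> A \<times> A. cls (fst z \<otimes> snd z) = ?w}"
    proof -
      let ?Z = "{z \<in> A \<times> A. cls (fst z \<otimes> snd z) = ?w}"
      have "(\<lambda>z. fst z \<otimes> snd z) ` ?Z \<subseteq> ?D" using A_in by auto
      moreover have "finite ?Z" using finite_A by simp
      ultimately have "(\<Sum>g\<in>?D. card {z \<in> ?Z. fst z \<otimes> snd z = g}) = card ?Z"
        using sum.group[OF _ finD, of ?Z "\<lambda>z. fst z \<otimes> snd z" "\<lambda>_. 1::nat"] by simp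
      moreover have "r g = card {z \<in> ?Z. fst z \<otimes> snd z = g}" if "g \<in> ?D" for g
        unfolding r_def using that by (intro arg_cong[of _ _ card]) auto
      ultimately show ?thesis by simp
    qed
    also have "{z \<in> A \<times> A. cls (fst z \<otimes> snd z) = ?w} = (SIGMA x:A. {y \<in> A. cls (x \<otimes> y) = ?w})" by auto
    also have "card \<dots> = (\<Sum>x\<in>A. card {y \<in> A. cls (x \<otimes> y) = ?w})" using finite_A by simp
    finally have "int (\<Sum>g\<in>?D. r g) = (\<Sum>x\<in>A. int (card {y \<in> A. cls (x \<otimes> y) = ?w}))" by simp
    also have "\<dots> = (\<Sum>x\<in>A. int q + (if cls x = v0 then 1 else 0))"
    proof (intro sum.cong refl)
      fix x assume x: "x \<in> A"
      then have xG: "x \<in> carrier G" using A_in by blast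
      have x3: "c1 x ^ 3 = 1" "c2 x ^ 3 = 1" using characterD(1)[OF c1 xG] characterD(1)[OF c2 xG] p3 by auto
      then have x0: "c1 x \<noteq> 0" "c2 x \<noteq> 0" by auto
      have v00: "fst v0 \<noteq> 0" "snd v0 \<noteq> 0" using R_nonzero v0(1) by auto
      let ?u = "(inverse (fst v0 * c1 x), inverse (snd v0 * c2 x))"
      have uR: "?u \<in> R" unfolding R_def using v03 x3 by (simp add: p3 power_mult_distrib power_inverse)
      have "cls (x \<otimes> y) = ?w \<longleftrightarrow> cls y = ?u" if "y \<in> A" for y
        using cls_mult[OF xG A_in[OF that]] x0 v00 by (auto simp: cls_def dual_def field_simps)
      then have "{y \<in> A. cls (x \<otimes> y) = ?w} = {y \<in> A. cls y = ?u}" by auto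
      moreover have "?u = v0 \<longleftrightarrow> cls x = v0"
      proof -
        have aux: "inverse (v * z) = v \<longleftrightarrow> z = v" if "z ^ 3 = 1" "v ^ 3 = 1" for v z :: complex
        proof -
          have "v \<noteq> 0" "z \<noteq> 0" using that by auto
          then have "inverse (v * z) = v \<longleftrightarrow> v * v = inverse z" by (auto simp: field_simps)
          then show ?thesis using root3[OF that(2,1)] by auto
        qed
        show ?thesis using aux[OF x3(1) v03(1)] aux[OF x3(2) v03(2)] by (auto simp: cls_def prod_eq_iff)
      qed
      ultimately show "int (card {y \<in> A. cls (x \<otimes> y) = ?w}) = int q + (if cls x = v0 then 1 else 0)"
        using v0(2)[OF uR] by simp
    qed
    also have "\<dots> = int (card A) * int q + int (card ?A0)"
      using finite_A by (simp add: sum.distrib sum.If_cases Int_def)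
    also have "int (card ?A0) = int q + 1" using v0(2)[OF v0(1)] by simp
    finally show ?thesis by simp
  qed
  moreover have "4 * card (?U - ?S) + card (?U \<inter> ?S) \<le> (\<Sum>g\<in>?D. r g)"
  proof -
    have fU: "finite ?U" using finD by simp
    have "4 * card (?U - ?S) = (\<Sum>g\<in>?U - ?S. 4)" by simp
    also have "\<dots> \<le> (\<Sum>g\<in>?U - ?S. r g)" using r4 by (rule sum_mono)
    finally have 1: "4 * card (?U - ?S) \<le> (\<Sum>g\<in>?U - ?S. r g)" .
    have "card (?U \<inter> ?S) = (\<Sum>g\<in>?U \<inter> ?S. 1)" by simp
    also have "\<dots> \<le> (\<Sum>g\<in>?U \<inter> ?S. r g)"
    proof (rule sum_mono)
      fix g assume "g \<in> ?U \<inter> ?S"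
      then have "r g mod 3 = 1" using r1 by blast
      then show "1 \<le> r g" by presburger
    qed
    finally have 2: "card (?U \<inter> ?S) \<le> (\<Sum>g\<in>?U \<inter> ?S. r g)" .
    have "(\<Sum>g\<in>?U. r g) = (\<Sum>g\<in>?U \<inter> ?S. r g) + (\<Sum>g\<in>?U - ?S. r g)"
      using fU by (rule sum.Int_Diff)
    moreover have "(\<Sum>g\<in>?U. r g) \<le> (\<Sum>g\<in>?D. r g)" using finD by (intro sum_mono2) auto
    ultimately show ?thesis using 1 2 by linarith
  qed
  moreover have "card ?U = card (?U - ?S) + card (?U \<inter> ?S)"
    using finD card_Diff_subset_Int[of ?U ?S] card_mono[of ?U "?U \<inter> ?S"] by simp
  moreover have "card (?U \<inter> ?S) \<le> q + 1"
  proof -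
    have "card (?U \<inter> ?S) \<le> card ?S" using finite_A by (intro card_mono) auto
    also have "\<dots> \<le> card ?A0" using finite_A by (intro card_image_le) auto
    also have "int (card ?A0) = int q + 1" using v0(2)[OF v0(1)] by simp
    then have "card ?A0 = q + 1" by linarith
    finally show ?thesis .
  qed
  \<comment> \<open>The left side is \<open>4 (8 q + 1) - 3 (q + 1)\<close>. With
    \<open>card A = 9 q + 1\<close> the inequality becomes \<open>27 q \<le> 9 q ^ 2\<close>, which
    fails for \<open>q\<close> = 1 and 2.\<close>
  ultimately have "29 * int q + 1 \<le> int (card A) * int q + int q + 1" using cU by linarith
  then have "29 * int q + 1 \<le> (9 * int q + 1) * int q + int q + 1" by (simp only: kk)
  moreover have "q = 1 \<or> q = 2" using q by linarith
  ultimately show False by auto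
qed

lemma small_prime_False:
  assumes "p \<le> 3" "card A > 1" "card B > 1" "order G < 200"
  shows False
proof -
  interpret BA: near_fact_pair G B A p c1 c2 by (rule near_fact_pair_swap)
  have lt: "card A * card B < 199" using card_eq assms(4) by simp
  have "p = 2 \<or> p = 3" using assms(1) p_gt_1 by auto
  then show False
  proof
    assume p2: "p = 2"
    have d: "4 dvd card A * card B + 1" using sq_dvd_order p2 by simp
    have "((card A mod 4) * (card B mod 4) + 1) mod 4 = 0"
      using mod_mult_add_1_eq_0[OF d] .
    then have "card A mod 4 = 1 \<and> card B mod 4 = 3 \<or> card A mod 4 = 3 \<and> card B mod 4 = 1"
      by (intro residues_mod_4) auto
    then show False
    proof
      assume "card A mod 4 = 1 \<and> card B mod 4 = 3"
      then show False
        using near_fact_order_2[OF p2, of "card A div 4" "card B div 4 + 1"] assms(2) by presburger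
    next
      assume "card A mod 4 = 3 \<and> card B mod 4 = 1"
      then show False
        using BA.near_fact_order_2[OF p2, of "card B div 4" "card A div 4 + 1"] assms(3) by presburger
    qed
  next
    assume p3: "p = 3"
    have d: "9 dvd card A * card B + 1" using sq_dvd_order p3 by simp
    have d1: "9 dvd card A ^ 2 + 8" using card_power_cong p3 by simp
    have "(card A mod 9)\<^sup>2 mod 9 = 1"
    proof -
      have "(card A ^ 2 + 8) mod 9 = 0" using d1 by (simp add: dvd_eq_mod_eq_0)
      then have "(card A ^ 2) mod 9 = 1" by presburger
      then show ?thesis by (simp add: power_mod)
    qed
    moreover have "((card A mod 9) * (card B mod 9) + 1) mod 9 = 0"
      using mod_mult_add_1_eq_0[OF d] .
    ultimately have "card A mod 9 = 1 \<and> card B mod 9 = 8 \<or> card A mod 9 = 8 \<and> card B mod 9 = 1"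
      by (intro residues_mod_9) auto
    then show False
    proof
      assume a: "card A mod 9 = 1 \<and> card B mod 9 = 8"
      \<comment> \<open>The bound on the order enters here: it leaves only 10 and 19 for the size
        congruent to 1 modulo 9, so that \<open>q \<le> 2\<close>.\<close>
      then have "card B \<ge> 8" by presburger
      then have "card A * 8 \<le> card A * card B" by simp
      then have "card A \<le> 24" using lt by linarith
      then show False
        using a near_fact_order_3[OF p3, of "card A div 9" "card B div 9 + 1"] assms(2) by presburger
    next
      assume a: "card A mod 9 = 8 \<and> card B mod 9 = 1"
      then have "card A \<ge> 8" by presburger
      then have "8 * card B \<le> card A * card B" by simp
      then have "card B \<le> 24" using lt by linarith
      then show False
        using a BA.near_fact_order_3[OF p3, of "card B div 9" "card A div 9 + 1"] assms(3) by presburger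
    qed
  qed
qed

end

section \<open>The primes 5 and 11\<close>

text \<open>Both \<open>p ^ 2\<close> and \<open>k ^ 2\<close> are below \<open>15 ^ 2\<close>, so a
  finite search remains. For \<open>p = 11\<close> and \<open>k = 3\<close> the size
  \<open>k'\<close> is left open, because \<open>near_fact_order_11\<close> uses only the factor of
  size 3.\<close>

lemma large_prime_parameters:
  fixes p k k' :: nat
  assumes p: "prime p" "p > 3" and d1: "p\<^sup>2 dvd k ^ (p - 1) + (p\<^sup>2 - 1)" and d2: "p\<^sup>2 dvd k * k' + 1"
    and k: "k > 1" "k \<le> k'" "k * k' < 199"
  shows "p = 5 \<and> k = 7 \<and> k' = 7 \<or> p = 11 \<and> k = 3"
proof -
  have "p\<^sup>2 \<le> k * k' + 1" using d2 by (rule dvd_imp_le) simp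
  then have "p * p < 15 * 15" using k by (simp add: power2_eq_square)
  then have "p < 15" by (metis mult_le_mono not_le)
  then have "p = 4 \<or> p = 5 \<or> p = 6 \<or> p = 7 \<or> p = 8 \<or> p = 9 \<or> p = 10 \<or> p = 11 \<or> p = 12 \<or> p = 13 \<or> p = 14"
    using p(2) by presburger
  moreover have "\<not> 2 dvd p" using prime_odd_nat[OF p(1)] p(2) by simp
  moreover have "\<not> 3 dvd p" using primes_dvd_imp_eq[of 3 p] p by auto
  ultimately have pc: "p = 5 \<or> p = 7 \<or> p = 11 \<or> p = 13" by auto
  have "k * k \<le> k * k'" using k by simp
  then have "k * k < 15 * 15" using k by linarith
  then have "k < 15" by (metis mult_le_mono not_le)
  then have kc: "k = 2 \<or> k = 3 \<or> k = 4 \<or> k = 5 \<or> k = 6 \<or> k = 7 \<or> k = 8 \<or> k = 9 \<or> k = 10 \<or> k = 11 \<or> k = 12 \<or> k = 13 \<or> k = 14"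
    using k(1) by presburger
  \<comment> \<open>The survivors come from \<open>7 ^ 4 = 96 * 25 + 1\<close> and
    \<open>3 ^ 5 = 2 * 121 + 1\<close>; the value 9 is the square of 3.\<close>
  from pc d1 kc have "p = 5 \<and> k = 7 \<or> p = 11 \<and> k = 3 \<or> p = 11 \<and> k = 9"
    by (elim disjE) simp_all
  then show ?thesis
  proof (elim disjE conjE)
    assume e: "p = 5" "k = 7"
    then have "25 dvd 7 * k' + 1" "7 * k' < 199" "7 \<le> k'" using d2 k by simp_all
    then have "k' = 7" by presburger
    then show ?thesis using e by simp
  next
    assume e: "p = 11" "k = 9"
    then have "121 dvd 9 * k' + 1" and lt: "9 * k' < 199" using d2 k by simp_all
    then obtain t where t: "9 * k' + 1 = 121 * t" by (auto elim: dvdE)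
    then have "t = 0 \<or> t = 1" using lt by linarith
    then have "9 * k' = 120" using t by auto
    then show ?thesis by presburger
  qed simp
qed

section \<open>A factor of size 3 for the prime 11\<close>

lemma norm_root_of_unity:
  fixes z :: complex
  assumes "z ^ p = 1" "p > 0"
  shows "norm z = 1"
proof -
  have "norm z ^ p = 1 ^ p" using assms(1) by (metis norm_one norm_power power_one)
  then show ?thesis using power_eq_iff_eq_base[OF assms(2), of "norm z" 1] by simp
qed

text \<open>The equality case of the triangle inequality, read off from expanding the square of the
  norm of \<open>2 * u + v\<close> around that of \<open>u + v\<close>.\<close>

lemma norm_two_add_eq_1:
  fixes u v :: complex
  assumes "norm u = 1" "norm v = 1" "norm (2 * u + v) = 1"
  shows "v = - u"
proof -
  have "(norm (2 * u + v))\<^sup>2 = 2 * (norm (u + v))\<^sup>2 + 2 * (norm u)\<^sup>2 - (norm v)\<^sup>2"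
    unfolding cmod_power2 by (simp add: power2_eq_square algebra_simps)
  then have "(norm (u + v))\<^sup>2 = 0" using assms by simp
  then show ?thesis by (simp add: add_eq_0_iff2)
qed

context near_fact_pair
begin

text \<open>Some nontrivial character identifies two of the three elements of \<open>A\<close>, so its
  sum over \<open>A\<close> and all conjugates of that sum have modulus at least 1, with product 1.\<close>

lemma near_fact_order_11:
  assumes p11: "p = 11" and k: "card A = 3"
  shows False
proof -
  obtain x y z where A: "A = {x, y, z}" "x \<noteq> y" "x \<noteq> z" "y \<noteq> z"
    using k by (metis card_3_iff)
  have G: "x \<in> carrier G" "y \<in> carrier G" "z \<in> carrier G" using A_in A by auto
  define d1 where "d1 = c1 x * inverse (c1 y)"
  define d2 where "d2 = c2 x * inverse (c2 y)"
  have d: "d1 ^ p = 1" "d2 ^ p = 1" unfolding d1_def d2_def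
    using characterD(1)[OF c1] characterD(1)[OF c2] G by (simp_all add: power_mult_distrib power_inverse)
  \<comment> \<open>If \<open>d1\<close> is not 1, its powers are all the \<open>p\<close>-th roots
    of unity, so one of them is \<open>inverse d2\<close> and \<open>j = 1\<close> works.\<close>
  obtain i j where ij: "i < p" "j < p" "(i, j) \<noteq> (0, 0)" "d1 ^ i * d2 ^ j = 1"
  proof (cases "d1 = 1")
    case True
    then show ?thesis using that[of 1 0] p_gt_1 by simp
  next
    case False
    have ninj: "d1 ^ n \<noteq> 1" if "0 < n" "n < p" for n
    proof
      assume "d1 ^ n = 1"
      moreover have "coprime n p" using that p by (metis coprime_commute dvd_imp_le not_le prime_imp_coprime)
      ultimately show False using root_of_unity_coprime[OF d(1)] False by blast
    qed
    have d0: "d1 \<noteq> 0" using d(1) p_gt_1 by (auto simp: zero_power)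
    have "inj_on (\<lambda>i. d1 ^ i) {..<p}"
    proof (rule linorder_inj_onI')
      fix i j assume "i \<in> {..<p}" "j \<in> {..<p}" "i < j"
      then have "d1 ^ (j - i) \<noteq> 1" by (intro ninj) auto
      moreover have "d1 ^ j = d1 ^ i * d1 ^ (j - i)" using \<open>i < j\<close> by (simp flip: power_add)
      ultimately show "d1 ^ i \<noteq> d1 ^ j" using d0 by auto
    qed
    then have "card ((\<lambda>i. d1 ^ i) ` {..<p}) = card {z::complex. z ^ p = 1}"
      using p_gt_1 by (simp add: card_image card_roots_unity_eq)
    moreover have "(\<lambda>i. d1 ^ i) ` {..<p} \<subseteq> {z. z ^ p = 1}"
    proof clarsimp
      fix i
      have "(d1 ^ i) ^ p = (d1 ^ p) ^ i" by (simp add: mult.commute flip: power_mult)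
      then show "(d1 ^ i) ^ p = 1" using d(1) by simp
    qed
    moreover have "finite {z::complex. z ^ p = 1}" using p_gt_1 by (intro finite_roots_unity) simp
    ultimately have "(\<lambda>i. d1 ^ i) ` {..<p} = {z. z ^ p = 1}" by (metis card_subset_eq)
    moreover have "inverse d2 \<in> {z. z ^ p = 1}" using d(2) by (simp add: power_inverse)
    ultimately obtain i where "i < p" "inverse d2 = d1 ^ i" by auto
    moreover have "d2 \<noteq> 0" using d(2) p_gt_1 by (auto simp: zero_power)
    ultimately have "d1 ^ i * d2 ^ 1 = 1" by (metis left_inverse power_one_right)
    then show ?thesis using that[of i 1] p_gt_1 \<open>i < p\<close> by simp
  qed
  have nz: "c1 y \<noteq> 0" "c2 y \<noteq> 0" using characterD(1)[OF c1 G(2)] characterD(1)[OF c2 G(2)] p_gt_1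
    by (auto simp: zero_power)
  have eq: "chr i j x = chr i j y"
    using ij(4) nz unfolding d1_def d2_def by (simp add: power_mult_distrib power_inverse field_simps)
  obtain g where g: "g \<in> carrier G" "chr i j g \<noteq> 1" using indep[OF ij(1-3)] by blast
  define u where "u = chr i j x"
  define v where "v = chr i j z"
  have uv: "u ^ p = 1" "v ^ p = 1" unfolding u_def v_def
    using characterD(1)[OF chr_character] G by auto
  then have n1: "norm u = 1" "norm v = 1" using norm_root_of_unity p_gt_1 by auto
  have S: "chi_sum A (\<lambda>x. chr i j x ^ t) = 2 * u ^ t + v ^ t" for t
    unfolding chi_sum_def u_def v_def A(1) using A(2-4) eq by simp
  have N: "(\<Prod>t\<in>{1..<p}. 2 * u ^ t + v ^ t) = 1"
    using norm_chi_sum[OF chr_character p _ g] p11 unfolding S by simp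
  have ge: "norm (2 * u ^ t + v ^ t) \<ge> 1" for t
  proof -
    have "norm (2 * u ^ t) \<le> norm (2 * u ^ t + v ^ t) + norm (v ^ t)"
      by (metis add_diff_cancel_right' norm_triangle_ineq4)
    then show ?thesis using n1 by (simp add: norm_mult norm_power)
  qed
  have "1 = (\<Prod>t\<in>{1..<p}. norm (2 * u ^ t + v ^ t))"
    using N by (metis norm_one prod_norm)
  also have "\<dots> = norm (2 * u ^ 1 + v ^ 1) * (\<Prod>t\<in>{1..<p} - {1}. norm (2 * u ^ t + v ^ t))"
    using p_gt_1 by (intro prod.remove) auto
  also have "\<dots> \<ge> norm (2 * u ^ 1 + v ^ 1) * 1"
    using ge by (intro mult_left_mono prod_ge_1) auto
  finally have "norm (2 * u + v) \<le> 1" by simp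
  then have "norm (2 * u + v) = 1" using ge[of 1] by simp
  then have "v = - u" using norm_two_add_eq_1 n1 by blast
  \<comment> \<open>Because 11 is odd the sign survives, whereas both powers are 1.\<close>
  then have "v ^ p = - (u ^ p)" by (simp add: p11)
  then show False using uv by simp
qed

end

section \<open>Two factors of size 7 in a group of order 50\<close>

context near_fact
begin

text \<open>On \<open>Y\<close> the function \<open>(1 + e) / 2\<close> is the indicator of the
  kernel of \<open>e\<close>.\<close>

lemma chi_sum_even_part:
  assumes e: "character G 2 e" and Y: "Y \<subseteq> carrier G"
  shows "2 * chi_sum {x \<in> Y. e x = 1} c = chi_sum Y c + chi_sum Y (\<lambda>x. c x * e x)"
proof -
  have fY: "finite Y" by (rule finite_subset[OF Y fin])
  have ex: "e x = 1 \<or> e x = -1" if "x \<in> Y" for x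
    using characterD(1)[OF e] Y that by (auto simp: power2_eq_1_iff)
  have "chi_sum {x \<in> Y. e x = 1} c = (\<Sum>x\<in>Y. if e x = 1 then c x else 0)"
    unfolding chi_sum_def using fY by (simp add: sum.If_cases Int_def)
  then have "2 * chi_sum {x \<in> Y. e x = 1} c = (\<Sum>x\<in>Y. 2 * (if e x = 1 then c x else 0))"
    by (simp add: sum_distrib_left)
  also have "\<dots> = (\<Sum>x\<in>Y. c x + c x * e x)" using ex by (intro sum.cong) force+
  finally show ?thesis by (simp add: chi_sum_def sum.distrib)
qed

lemma card_even_part:
  assumes e: "character G 2 e" and Y: "Y \<subseteq> carrier G"
  shows "2 * of_nat (card {x \<in> Y. e x = 1}) = of_nat (card Y) + chi_sum Y e"
  using chi_sum_even_part[OF e Y, of "\<lambda>_. 1"] by (simp add: chi_sum_def)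

text \<open>The elements \<open>x\<^sup>2 b\<close> with \<open>e b = 1\<close> run exactly once through the \<open>21\<close> elements of
  the kernel of \<open>e\<close> that are not in \<open>A\<close>.\<close>

lemma order_50_twist:
  assumes k: "card A = 7" "card B = 7" and e: "character G 2 e" "g2 \<in> carrier G" "e g2 \<noteq> 1"
    and eA: "chi_sum A e = 1" and c: "character G 5 c" "g5 \<in> carrier G" "c g5 \<noteq> 1"
  shows "chi_sum A (\<lambda>x. c x ^ 2) = chi_sum A c * chi_sum A (\<lambda>x. c x * e x)"
proof -
  have n50: "order G = 50" using card_eq k by simp
  have ce: "character G 10 (\<lambda>x. c x * e x)"
    by (intro character_mult character_mono[OF c(1)] character_mono[OF e(1)]) auto
  have "coprime 2 (5::nat)" by simp
  then have "c g5 ^ 2 \<noteq> 1"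
    using root_of_unity_coprime[of "c g5" 5 2] characterD(1)[OF c(1,2)] c(3) by blast
  moreover have "e g5 ^ 2 = 1" using characterD(1)[OF e(1) c(2)] .
  ultimately have "(c g5 * e g5) ^ 2 \<noteq> 1" by (simp add: power_mult_distrib)
  then have ceg: "c g5 * e g5 \<noteq> 1" by auto
  let ?E = "{x \<in> carrier G. e x = 1}" and ?A = "{x \<in> A. e x = 1}" and ?B = "{x \<in> B. e x = 1}"
  \<comment> \<open>With sums 1 and -1, the kernel of \<open>e\<close> contains 4 elements of
    \<open>A\<close> and 3 elements of \<open>B\<close>.\<close>
  have eB: "chi_sum B e = -1" using chi_sum_mult[OF e(1) _ e(2,3)] eA by simp
  have "2 * of_nat (card ?A) = (of_nat (2 * 4) :: complex)" using card_even_part[OF e(1) A_carrier] k eA by simp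
  then have "of_nat (card ?A) = (of_nat 4 :: complex)" by simp
  then have cA: "card ?A = 4" by (simp only: of_nat_eq_iff)
  have "2 * of_nat (card ?B) = (of_nat (2 * 3) :: complex)" using card_even_part[OF e(1) B_carrier] k eB by simp
  then have "of_nat (card ?B) = (of_nat 3 :: complex)" by simp
  then have cB: "card ?B = 3" by (simp only: of_nat_eq_iff)
  have "chi_sum (carrier G) e = 0" unfolding chi_sum_def using sum_character_carrier[OF e] .
  then have "2 * of_nat (card ?E) = (of_nat (2 * 25) :: complex)"
    using card_even_part[OF e(1) subset_refl] n50 by (simp add: order_def)
  then have "of_nat (card ?E) = (of_nat 25 :: complex)" by simp
  then have cE: "card ?E = 25" by (simp only: of_nat_eq_iff)
  have finE: "finite ?E" using fin by simp
  have "?A \<subseteq> ?E" using A_in by auto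
  moreover have "?E - A = ?E - ?A" by auto
  ultimately have cEA: "card (?E - A) = 21"
    using card_Diff_subset[of ?A ?E] finite_A cA cE by simp
  let ?h = "\<lambda>(x, b). x \<otimes> x \<otimes> b"
  have e1: "e (x \<otimes> x \<otimes> b) = e b" if "x \<in> A" "b \<in> B" for x b
    using that A_in B_in characterD[OF e(1)] by (simp add: power2_eq_square)
  have sub: "?E - A \<subseteq> ?h ` (A \<times> ?B)"
  proof
    fix g assume g: "g \<in> ?E - A"
    then obtain x b where xb: "x \<in> A" "b \<in> B" "g = x \<otimes> x \<otimes> b"
      using mem_square_mult[of g] k by auto
    then show "g \<in> ?h ` (A \<times> ?B)" using g e1[OF xb(1,2)] by (intro image_eqI[of _ _ "(x, b)"]) auto
  qed
  have fAB: "finite (A \<times> ?B)" using finite_A finite_B by simp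
  \<comment> \<open>The \<open>7 * 3\<close> products cover the \<open>25 - 4\<close> elements of
    \<open>?E - A\<close>, so no product is repeated.\<close>
  have cAB: "card (A \<times> ?B) = 21" using k cB by (simp add: card_cartesian_product)
  have "card (?h ` (A \<times> ?B)) \<le> card (?E - A)" using card_image_le[OF fAB, of ?h] cAB cEA by simp
  then have im: "?E - A = ?h ` (A \<times> ?B)" using card_seteq[OF finite_imageI[OF fAB] sub] by simp
  have inj: "inj_on ?h (A \<times> ?B)" using fAB im cAB cEA by (intro eq_card_imp_inj_on) simp_all
  have cx: "c (x \<otimes> x \<otimes> b) = c x ^ 2 * c b" if "x \<in> A" "b \<in> B" for x b
    using that A_in B_in characterD(2)[OF c(1)] by (simp add: power2_eq_square)
  have "chi_sum A (\<lambda>x. c x ^ 2) * chi_sum ?B c = (\<Sum>(x, b)\<in>A \<times> ?B. c x ^ 2 * c b)"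
    unfolding chi_sum_def sum_product by (simp add: sum.cartesian_product)
  also have "\<dots> = (\<Sum>z\<in>A \<times> ?B. c (?h z))" using cx by (intro sum.cong) auto
  also have "\<dots> = (\<Sum>g\<in>?E - A. c g)" unfolding im by (simp add: sum.reindex[OF inj])
  also have "\<dots> = (\<Sum>g\<in>?E. c g) - (\<Sum>g\<in>?A. c g)"
    using \<open>?E - A = ?E - ?A\<close> sum_diff[OF finE \<open>?A \<subseteq> ?E\<close>, of c] by simp
  also have "(\<Sum>g\<in>?E. c g) = 0"
  proof -
    have 1: "chi_sum (carrier G) c = 0" unfolding chi_sum_def using sum_character_carrier[OF c] .
    from sum_character_carrier[OF ce c(2) ceg]
    have "chi_sum (carrier G) (\<lambda>x. c x * e x) = 0" unfolding chi_sum_def .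
    then have "2 * chi_sum ?E c = 0" using chi_sum_even_part[OF e(1) subset_refl, of c] 1 by simp
    then show ?thesis by (simp add: chi_sum_def)
  qed
  finally have main: "chi_sum A (\<lambda>x. c x ^ 2) * chi_sum ?B c = - chi_sum ?A c" by (simp add: chi_sum_def)
  let ?f = "chi_sum A c" and ?g = "chi_sum A (\<lambda>x. c x * e x)"
  let ?f' = "chi_sum B c" and ?g' = "chi_sum B (\<lambda>x. c x * e x)"
  have ff: "?f * ?f' = -1" using chi_sum_mult[OF c(1) _ c(2,3)] by simp
  have gg: "?g * ?g' = -1"
    using chi_sum_mult[OF ce _ c(2) ceg] by simp
  \<comment> \<open>The norm of this sum is congruent to \<open>4 ^ 4 = 256\<close> modulo 5, hence
    not 0.\<close>
  have nz: "chi_sum ?A c \<noteq> 0"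
  proof
    assume z: "chi_sum ?A c = 0"
    have "prime (5::nat)" by simp
    moreover have "finite ?A" using finite_A by simp
    ultimately obtain m where "(\<Prod>t\<in>{1..<5}. chi_sum ?A (\<lambda>x. c x ^ t)) = of_int (int (card ?A) ^ (5 - 1) - int 5 * int m)"
      using chi_sum_norm_int[of 5 ?A c] characterD(1)[OF c(1)] A_in by blast
    moreover have "(\<Prod>t\<in>{1..<5}. chi_sum ?A (\<lambda>x. c x ^ t)) = 0"
      using z by (intro prod_zero bexI[of _ 1]) auto
    ultimately have "of_int (256 - 5 * int m) = (0::complex)" by (simp add: cA)
    then have "256 - 5 * int m = 0" by (simp only: of_int_eq_0_iff)
    then show False by presburger
  qed
  have A2: "2 * chi_sum ?A c = ?f + ?g" using chi_sum_even_part[OF e(1) A_carrier, of c] .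
  have B2: "2 * chi_sum ?B c = ?f' + ?g'" using chi_sum_even_part[OF e(1) B_carrier, of c] .
  have "chi_sum A (\<lambda>x. c x ^ 2) * (2 * chi_sum ?B c) = - (2 * chi_sum ?A c)"
    using main by (simp add: algebra_simps)
  then have "chi_sum A (\<lambda>x. c x ^ 2) * (?f' + ?g') = - (?f + ?g)" unfolding A2 B2 .
  \<comment> \<open>Multiplying by \<open>?f * ?g\<close> removes \<open>?f'\<close> and
    \<open>?g'\<close>, since \<open>?f * ?f'\<close> and \<open>?g * ?g'\<close> are -1. What then
    cancels is \<open>?f + ?g\<close>, twice the nonzero sum over \<open>?A\<close>.\<close>
  then have "chi_sum A (\<lambda>x. c x ^ 2) * ((?f' + ?g') * (?f * ?g)) = - (?f + ?g) * (?f * ?g)"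
    by (simp flip: mult.assoc)
  moreover have "(?f' + ?g') * (?f * ?g) = - (?f + ?g)"
  proof -
    have "(?f' + ?g') * (?f * ?g) = (?f * ?f') * ?g + (?g * ?g') * ?f" by (simp add: algebra_simps)
    then show ?thesis unfolding ff gg by simp
  qed
  ultimately have "chi_sum A (\<lambda>x. c x ^ 2) * - (?f + ?g) = - (?f + ?g) * (?f * ?g)" by simp
  then have "chi_sum A (\<lambda>x. c x ^ 2) * (?f + ?g) = (?f * ?g) * (?f + ?g)"
    by (simp only: mult_minus_right mult_minus_left neg_equal_iff_equal) (simp only: mult.commute)
  moreover have "?f + ?g \<noteq> 0" using nz A2 by auto
  ultimately show ?thesis by simp
qed

end

context near_fact
begin

text \<open>Writing \<open>a\<close> and \<open>b\<close> for the squared moduli of the sums of \<open>c\<close> and \<open>c\<^sup>2\<close> over \<open>A\<close>, the norm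
  gives \<open>a b = 1\<close> and the twisted sums give \<open>a, b \<le> 7\<close>; then \<open>2 (a + b) = 5 E - 49\<close> with \<open>E\<close> odd
  leaves only \<open>E = 11\<close>.\<close>

lemma order_50_kernel_pairs:
  assumes k: "card A = 7" "card B = 7" and e: "character G 2 e" "g2 \<in> carrier G" "e g2 \<noteq> 1"
    and eA: "chi_sum A e = 1" and c: "character G 5 c" "g5 \<in> carrier G" "c g5 \<noteq> 1"
  shows "card {z \<in> A \<times> A. c (fst z) * c (snd z) ^ 4 = 1} = 11"
proof -
  define f where "f t = chi_sum A (\<lambda>x. c x ^ t)" for t
  have c5: "c x ^ 5 = 1" if "x \<in> A" for x using characterD(1)[OF c(1)] A_in[OF that] .
  have per: "f (t + 5) = f t" for t
    unfolding f_def chi_sum_def using c5 by (intro sum.cong) (simp_all add: power_add)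
  have cnj: "f (4 * t) = cnj (f t)" for t
  proof -
    have "cnj (c x) = c x ^ 4" if "x \<in> A" for x
    proof -
      have n: "norm (c x) = 1" using norm_root_of_unity[OF c5[OF that]] by simp
      have "c x * cnj (c x) = 1" using complex_norm_square[of "c x"] n by simp
      moreover have "c x * c x ^ 4 = 1" using c5[OF that] by (simp flip: power_Suc)
      ultimately show ?thesis by (metis inverse_unique)
    qed
    then show ?thesis unfolding f_def chi_sum_def by (auto simp: power_mult intro!: sum.cong)
  qed
  have f3: "f 3 = cnj (f 2)" using cnj[of 2] per[of 3] by simp
  have f4: "f 4 = cnj (f 1)" using cnj[of 1] by simp
  define a where "a = (norm (f 1))\<^sup>2"
  define b where "b = (norm (f 2))\<^sup>2"
  have ab: "a * b = 1"
  proof -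
    have "prime (5::nat)" by simp
    from norm_chi_sum[OF c(1) this _ c(2,3)] have "(\<Prod>t\<in>{1..<5}. f t) = 1" unfolding f_def by simp
    moreover have "(\<Prod>t\<in>{1..<5}. f t) = f 1 * f 2 * f 3 * f 4"
      by (simp add: eval_nat_numeral)
    ultimately have "(f 1 * cnj (f 1)) * (f 2 * cnj (f 2)) = 1" unfolding f3 f4 by (simp add: mult_ac)
    then have "of_real (a * b) = (1::complex)" by (simp only: a_def b_def of_real_mult complex_norm_square)
    then show ?thesis by (simp only: of_real_eq_1_iff)
  qed
  have ab0: "a \<ge> 0" "b \<ge> 0" unfolding a_def b_def by auto
  have tw: "norm (chi_sum A (\<lambda>x. d x * e x)) \<le> 7" if d: "character G 5 d" for d
  proof -
    have "norm (d x * e x) = 1" if "x \<in> A" for x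
      using norm_root_of_unity[OF characterD(1)[OF d]] norm_root_of_unity[OF characterD(1)[OF e(1)]] A_in[OF that]
      by (simp add: norm_mult)
    then have "norm (chi_sum A (\<lambda>x. d x * e x)) \<le> (\<Sum>x\<in>A. 1)"
      unfolding chi_sum_def by (intro sum_norm_le) simp
    then show ?thesis using k by simp
  qed
  have "a \<le> 7 \<and> b \<le> 7"
  proof -
    have c2: "character G 5 (\<lambda>x. c x ^ 2)" by (rule character_power[OF c(1)])
    have "coprime 2 (5::nat)" by simp
    then have c2n: "c g5 ^ 2 \<noteq> 1"
      using root_of_unity_coprime[of "c g5" 5 2] characterD(1)[OF c(1,2)] c(3) by blast
    define m where "m = norm (chi_sum A (\<lambda>x. c x * e x))"
    define n where "n = norm (chi_sum A (\<lambda>x. c x ^ 2 * e x))"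
    \<comment> \<open>The twist relation gives \<open>b = a * m ^ 2\<close>, and with
      \<open>a * b = 1\<close> this becomes \<open>b = m\<close>. Applied to the square of
      \<open>c\<close>, whose own square is the conjugate of \<open>c\<close>, it gives
      \<open>a = n\<close>. A twisted sum has 7 terms of modulus 1.\<close>
    have "f 2 = f 1 * chi_sum A (\<lambda>x. c x * e x)"
      using order_50_twist[OF k e eA c] unfolding f_def by simp
    then have "b = a * m\<^sup>2" unfolding a_def b_def m_def by (simp add: norm_mult power_mult_distrib)
    then have "b * b = (a * b) * m\<^sup>2" by simp
    then have "b\<^sup>2 = m\<^sup>2" unfolding ab by (simp add: power2_eq_square)
    then have 1: "b = m" using ab0 by (simp add: m_def)
    have "f 4 = f 2 * chi_sum A (\<lambda>x. c x ^ 2 * e x)"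
      using order_50_twist[OF k e eA c2 c(2) c2n] unfolding f_def by (simp flip: power_mult)
    then have "norm (f 4) = norm (f 2) * n" by (simp add: norm_mult n_def)
    then have "norm (f 1) = norm (f 2) * n" unfolding f4 by simp
    then have "a = b * n\<^sup>2" unfolding a_def b_def by (simp add: power_mult_distrib)
    then have "a * a = (a * b) * n\<^sup>2" by simp
    then have "a\<^sup>2 = n\<^sup>2" unfolding ab by (simp add: power2_eq_square)
    then have "a = n" using ab0 by (simp add: n_def)
    then show ?thesis using 1 tw[OF c(1)] tw[OF c2] unfolding m_def n_def by simp
  qed
  then have a7: "a \<le> 7" "b \<le> 7" by auto
  let ?Z = "{z \<in> A \<times> A. c (fst z) * c (snd z) ^ 4 = 1}"
  have fAA: "finite (A \<times> A)" using finite_A by simp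
  have Z: "of_nat (5 * card ?Z) = (\<Sum>i<5. \<Sum>z\<in>A \<times> A. (c (fst z) * c (snd z) ^ 4) ^ i)"
  proof (rule card_eq_sum_roots_of_unity[OF fAA])
    fix z assume "z \<in> A \<times> A"
    then have "c (fst z) ^ 5 = 1" "c (snd z) ^ 5 = 1" using c5 by auto
    moreover have "(c (fst z) * c (snd z) ^ 4) ^ 5 = c (fst z) ^ 5 * (c (snd z) ^ 5) ^ 4"
      by (simp add: power_mult_distrib flip: power_mult)
    ultimately show "(c (fst z) * c (snd z) ^ 4) ^ 5 = 1" by simp
  qed
  also have "\<dots> = (\<Sum>i<5. f i * cnj (f i))"
  proof (intro sum.cong refl)
    fix i :: nat
    have "(\<Sum>z\<in>A \<times> A. (c (fst z) * c (snd z) ^ 4) ^ i) = (\<Sum>(x, y)\<in>A \<times> A. c x ^ i * c y ^ (4 * i))"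
      by (simp add: case_prod_unfold power_mult_distrib power_mult)
    also have "\<dots> = f i * f (4 * i)" unfolding f_def chi_sum_def sum_product by (simp add: sum.cartesian_product)
    finally show "(\<Sum>z\<in>A \<times> A. (c (fst z) * c (snd z) ^ 4) ^ i) = f i * cnj (f i)" unfolding cnj .
  qed
  also have "\<dots> = (\<Sum>i<5. of_real ((norm (f i))\<^sup>2))" by (simp only: complex_norm_square)
  also have "\<dots> = of_real ((norm (f 0))\<^sup>2 + (norm (f 1))\<^sup>2 + (norm (f 2))\<^sup>2 + (norm (f 3))\<^sup>2 + (norm (f 4))\<^sup>2)"
    by (simp add: eval_nat_numeral)
  also have "\<dots> = of_real (49 + 2 * a + 2 * b)"
  proof -
    have "norm (f 0) = 7" unfolding f_def chi_sum_def using k by simp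
    then show ?thesis unfolding f3 f4 a_def b_def by simp
  qed
  finally have "of_real (real (5 * card ?Z)) = (of_real (49 + 2 * a + 2 * b) :: complex)"
    by (simp only: of_real_of_nat_eq)
  then have E: "5 * real (card ?Z) = 49 + 2 * a + 2 * b" by (simp only: of_real_eq_iff)
  have "a + b \<ge> 2"
  proof -
    have "(a + b)\<^sup>2 = (a - b)\<^sup>2 + 4 * (a * b)" by (simp add: power2_eq_square algebra_simps)
    then have "(a + b)\<^sup>2 \<ge> 2\<^sup>2" using ab by simp
    then show ?thesis using ab0 power2_le_imp_le[of 2 "a + b"] by simp
  qed
  then have lo: "card ?Z > 10" using E by linarith
  \<comment> \<open>The bounds \<open>a \<le> 7\<close> and \<open>b \<le> 7\<close> with
    \<open>a * b = 1\<close> yield \<open>a + b \<le> 50 / 7\<close>, which together with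
    \<open>a + b \<ge> 2\<close> leaves 11 and 12 for the count.\<close>
  have "0 \<le> (7 - a) * (7 - b)" using a7 by simp
  also have "\<dots> = 49 - 7 * (a + b) + a * b" by (simp add: algebra_simps)
  finally have "7 * (a + b) \<le> 50" using ab by simp
  then have "real (card ?Z) < 13" using E by argo
  then have hi: "card ?Z < 13" by simp
  have c0: "c x * c y ^ 4 = 1 \<longleftrightarrow> c x = c y" if "x \<in> A" "y \<in> A" for x y
  proof -
    have "c y * c y ^ 4 = 1" using c5[OF that(2)] by (simp flip: power_Suc)
    then show ?thesis by (metis mult.commute mult_cancel_right mult_zero_left zero_neq_one)
  qed
  \<comment> \<open>Parity decides: exchanging the components of a pair fixes exactly the 7 diagonal
    pairs.\<close>
  have "even (card ?Z) \<longleftrightarrow> even (card {z \<in> ?Z. prod.swap z = z})"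
    using fAA c0 by (intro even_card_involution) auto
  moreover have "{z \<in> ?Z. prod.swap z = z} = (\<lambda>x. (x, x)) ` A"
  proof -
    have 1: "c x * c x ^ 4 = 1" if "x \<in> A" for x using c0[OF that that] by simp
    have 2: "z \<in> (\<lambda>x. (x, x)) ` A" if "z \<in> A \<times> A" "prod.swap z = z" for z
    proof -
      have "snd z = fst (prod.swap z)" by simp
      also have "\<dots> = fst z" by (simp only: that(2))
      finally have "z = (fst z, fst z)" by (simp add: prod_eq_iff)
      moreover have "fst z \<in> A" using that(1) by auto
      ultimately show ?thesis by (rule image_eqI)
    qed
    show ?thesis
    proof (rule equalityI; rule subsetI)
      fix z assume "z \<in> {z \<in> ?Z. prod.swap z = z}"
      then have "z \<in> A \<times> A" "prod.swap z = z" by blast+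
      then show "z \<in> (\<lambda>x. (x, x)) ` A" by (rule 2)
    next
      fix z assume "z \<in> (\<lambda>x. (x, x)) ` A"
      then show "z \<in> {z \<in> ?Z. prod.swap z = z}" using 1 by auto
    qed
  qed
  moreover have "card ((\<lambda>x. (x, x)) ` A) = 7"
    using k by (subst card_image) (auto simp: inj_on_def)
  ultimately have "odd (card ?Z)" by simp
  then show ?thesis using lo hi by presburger
qed

text \<open>Inversion pairs off the elements that are not self-inverse, so the number of
  self-inverse elements is even and in particular not 1. Hence squaring is not onto, and a nonsquare
  is detected by a character.\<close>

lemma exists_order_2_character:
  assumes "even (order G)"
  obtains e g where "character G 2 e" "g \<in> carrier G" "e g \<noteq> 1"
proof -
  let ?K = "(\<lambda>x. x [^] (2::nat)) ` carrier G" and ?T = "{x \<in> carrier G. x [^] (2::nat) = \<one>}"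
  have "even (card (carrier G)) \<longleftrightarrow> even (card {x \<in> carrier G. inv x = x})"
    using fin by (intro even_card_involution) auto
  moreover have "{x \<in> carrier G. inv x = x} = ?T"
  proof -
    have "inv x = x \<longleftrightarrow> x \<otimes> x = \<one>" if "x \<in> carrier G" for x
      using that by (metis inv_equality r_inv)
    then show ?thesis by (auto simp: numeral_2_eq_2)
  qed
  ultimately have ev: "even (card ?T)" using assms by (simp add: order_def)
  have "\<not> carrier G \<subseteq> ?K"
  proof
    assume "carrier G \<subseteq> ?K"
    then have "?K = carrier G" by auto
    then have "order G = order G * card ?T"
      using order_eq_powers_mult_torsion[OF fin, of 2] by (simp add: order_def)
    moreover have "order G > 0" using fin by (simp add: order_gt_0_iff_finite)
    ultimately have "card ?T = 1" by simp
    then show False using ev by simp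
  qed
  then obtain h where "h \<in> carrier G" "h \<notin> ?K" by auto
  with exists_character[OF fin two_is_prime_nat] that show ?thesis by metis
qed

end

context near_fact_pair
begin

text \<open>Summing the previous count over all characters gives a multiple of \<open>25\<close>.\<close>

lemma near_fact_order_5_aux:
  assumes p5: "p = 5" and k: "card A = 7" "card B = 7"
    and e: "character G 2 e" "g2 \<in> carrier G" "e g2 \<noteq> 1" and eA: "chi_sum A e = 1"
  shows False
proof -
  let ?T = "A \<times> A"
  let ?u = "\<lambda>z. c1 (fst z) * c1 (snd z) ^ 4" and ?v = "\<lambda>z. c2 (fst z) * c2 (snd z) ^ 4"
  have fT: "finite ?T" using finite_A by simp
  have r: "?u z ^ 5 = 1" "?v z ^ 5 = 1" if "z \<in> ?T" for z
  proof -
    have w: "(c (fst z) * c (snd z) ^ 4) ^ 5 = 1" if c: "character G 5 c" for c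
    proof -
      have "c (fst z) ^ 5 = 1" "c (snd z) ^ 5 = 1"
        using characterD(1)[OF c] A_in \<open>z \<in> ?T\<close> by auto
      moreover have "(c (fst z) * c (snd z) ^ 4) ^ 5 = c (fst z) ^ 5 * (c (snd z) ^ 5) ^ 4"
        by (simp add: power_mult_distrib flip: power_mult)
      ultimately show ?thesis by simp
    qed
    show "?u z ^ 5 = 1" "?v z ^ 5 = 1" using w c1 c2 p5 by auto
  qed
  have rp: "(w ^ t) ^ 5 = 1" if "w ^ 5 = 1" for w :: complex and t
    using that by (metis mult.commute power_mult power_one)
  define E where "E i j = card {z \<in> ?T. ?u z ^ i * ?v z ^ j = 1}" for i j
  have E: "of_nat (5 * E i j) = (\<Sum>t<5. \<Sum>z\<in>?T. (?u z ^ t) ^ i * (?v z ^ t) ^ j)" for i j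
  proof -
    have "of_nat (5 * E i j) = (\<Sum>t<5. \<Sum>z\<in>?T. (?u z ^ i * ?v z ^ j) ^ t)"
      unfolding E_def
    proof (rule card_eq_sum_roots_of_unity[OF fT])
      fix z assume "z \<in> ?T"
      from rp[OF r(1)[OF this], of i] rp[OF r(2)[OF this], of j]
      show "(?u z ^ i * ?v z ^ j) ^ 5 = 1" unfolding power_mult_distrib[of "?u z ^ i" "?v z ^ j"] by simp
    qed
    moreover have "(x ^ i * y ^ j) ^ t = (x ^ t) ^ i * (y ^ t) ^ j" for x y :: complex and t
      by (simp add: power_mult_distrib mult.commute flip: power_mult)
    ultimately show ?thesis by (simp only:)
  qed
  \<comment> \<open>Each kernel count is itself a sum over \<open>t\<close>. With \<open>t\<close>
    moved outside, the sum over \<open>i\<close> and \<open>j\<close> for fixed \<open>t\<close> is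
    25 times a count.\<close>
  have "(\<Sum>i<5. \<Sum>j<5. of_nat (5 * E i j)) =
      (\<Sum>i<5. \<Sum>j<5. \<Sum>t<5. \<Sum>z\<in>?T. (?u z ^ t) ^ i * (?v z ^ t) ^ j)"
    by (simp only: E)
  also have "\<dots> = (\<Sum>i<5. \<Sum>t<5. \<Sum>j<5. \<Sum>z\<in>?T. (?u z ^ t) ^ i * (?v z ^ t) ^ j)"
    by (intro sum.cong refl sum.swap)
  also have "\<dots> = (\<Sum>t<5. \<Sum>i<5. \<Sum>j<5. \<Sum>z\<in>?T. (?u z ^ t) ^ i * (?v z ^ t) ^ j)"
    by (rule sum.swap)
  also have "\<dots> = (\<Sum>t<5. of_nat (5\<^sup>2 * card {z \<in> ?T. ?u z ^ t = 1 \<and> ?v z ^ t = 1}))"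
    using r rp by (intro sum.cong refl card_eq_sum_roots_of_unity2[symmetric] fT) auto
  finally have sumE: "(\<Sum>i<5. \<Sum>j<5. of_nat (5 * E i j)) =
      (of_nat (25 * (\<Sum>t<5. card {z \<in> ?T. ?u z ^ t = 1 \<and> ?v z ^ t = 1})) :: complex)"
    by (simp add: sum_distrib_left)
  have E11: "(of_nat (5 * E i j) :: complex) = 55" if ij: "i < p" "j < p" "(i, j) \<noteq> (0, 0)" for i j
  proof -
    obtain g where g: "g \<in> carrier G" "chr i j g \<noteq> 1" using indep[OF ij] by blast
    have "character G 5 (chr i j)" using chr_character[of i j] by (simp only: p5)
    from order_50_kernel_pairs[OF k e eA this g]
    have "card {z \<in> ?T. chr i j (fst z) * chr i j (snd z) ^ 4 = 1} = 11" .
    moreover have "chr i j (fst z) * chr i j (snd z) ^ 4 = ?u z ^ i * ?v z ^ j" for z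
      by (simp add: power_mult_distrib mult_ac flip: power_mult)
    ultimately have "E i j = 11" unfolding E_def by simp
    then show ?thesis by simp
  qed
  \<comment> \<open>The total is \<open>5 * 49 + 24 * 55 = 1565\<close>, which is 15 modulo
    25.\<close>
  have "(\<Sum>i<5. \<Sum>j<5. (of_nat (5 * E i j) :: complex)) = of_nat (5 * E 0 0) + of_nat (5\<^sup>2 - 1) * 55"
    using sum_pair_split[of "\<lambda>i j. of_nat (5 * E i j)", OF E11] unfolding p5 .
  also have "E 0 0 = 49" unfolding E_def using k by (simp add: card_cartesian_product)
  finally have "(of_nat 1565 :: complex) = of_nat (25 * (\<Sum>t<5. card {z \<in> ?T. ?u z ^ t = 1 \<and> ?v z ^ t = 1}))"
    using sumE by simp
  then have "1565 = 25 * (\<Sum>t<5. card {z \<in> ?T. ?u z ^ t = 1 \<and> ?v z ^ t = 1})"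
    by (simp only: of_nat_eq_iff)
  then show False by presburger
qed

text \<open>The sums of \<open>e\<close> over \<open>A\<close> and \<open>B\<close> are 1 and -1 in
  some order, so the sign required by \<open>near_fact_order_5_aux\<close> is reached after possibly
  exchanging the factors.\<close>

lemma near_fact_order_5:
  assumes p5: "p = 5" and k: "card A = 7" "card B = 7"
  shows False
proof -
  interpret BA: near_fact_pair G B A p c1 c2 by (rule near_fact_pair_swap)
  have "order G = 50" using card_eq k by simp
  then obtain e g where e: "character G 2 e" "g \<in> carrier G" "e g \<noteq> 1"
    using exists_order_2_character by auto
  from sum_order2[OF e] show False
  proof
    assume "chi_sum A e = 1"
    then show False using near_fact_order_5_aux[OF p5 k e] by simp
  next
    assume "chi_sum A e = -1"
    then have "chi_sum B e = 1" using chi_sum_mult[OF e(1) _ e(2,3)] by simp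
    then show False using BA.near_fact_order_5_aux[OF p5 k(2,1) e] by simp
  qed
qed

lemma large_prime_False:
  assumes "p > 3" "card A > 1" "card A \<le> card B" "order G < 200"
  shows False
proof -
  have lt: "card A * card B < 199" using card_eq assms(4) by simp
  have "p > 2" using assms(1) by simp
  from large_prime_parameters[OF p assms(1) card_power_cong[OF this] sq_dvd_order assms(2,3) lt]
  show False using near_fact_order_5 near_fact_order_11 by blast
qed

lemma False_if_order_lt_200:
  assumes "card A > 1" "card B > 1" "order G < 200"
  shows False
proof -
  interpret BA: near_fact_pair G B A p c1 c2 by (rule near_fact_pair_swap)
  consider "p \<le> 3" | "p > 3" "card A \<le> card B" | "p > 3" "card B \<le> card A" by linarith
  then show False
    using small_prime_False large_prime_False BA.large_prime_False assms by cases blast+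
qed

end


theorem mainTheorem3:
  fixes G :: "('a, 'b) monoid_scheme"
  assumes "comm_group G"
    and "finite (carrier G)"
    and "\<not> cyclic_group G"
    and "order G < 200"
  shows "\<not> (\<exists>A B. nontrivial_near_factorization G A B)"
proof
  assume "\<exists>A B. nontrivial_near_factorization G A B"
  then obtain A B where nf: "near_factorization G A B" and AB: "card A > 1" "card B > 1"
    by (auto simp: nontrivial_near_factorization_def)
  interpret comm_group G by (rule assms(1))
  obtain p c1 c2 g h where p: "prime p" and c: "character G p c1" "character G p c2"
    and g: "g \<in> carrier G" "c1 g \<noteq> 1" and h: "h \<in> carrier G" "c1 h = 1" "c2 h \<noteq> 1"
    using noncyclic_character_pair[OF assms(2,3)] .
  have cop: "coprime i p" if "i < p" "i \<noteq> 0" for i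
    using that p by (metis coprime_commute dvd_imp_le gr0I not_le prime_imp_coprime)
  interpret near_fact_pair G A B p c1 c2
  proof unfold_locales
    fix i j assume ij: "i < p" "j < p" "(i, j) \<noteq> (0, 0)"
    \<comment> \<open>The pair is triangular: \<open>g\<close> is a witness if \<open>j = 0\<close>,
      and otherwise \<open>h\<close> is one, as \<open>c1\<close> is trivial there.\<close>
    show "\<exists>g\<in>carrier G. c1 g ^ i * c2 g ^ j \<noteq> 1"
    proof (cases "j = 0")
      case True
      then have "c1 g ^ i \<noteq> 1"
        using root_of_unity_coprime[OF characterD(1)[OF c(1) g(1)], of i] cop[of i] ij g(2) by auto
      then show ?thesis using True g(1) by auto
    next
      case False
      then have "c2 h ^ j \<noteq> 1"
        using root_of_unity_coprime[OF characterD(1)[OF c(2) h(1)], of j] cop[of j] ij h(3) by auto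
      then show ?thesis using h by (intro bexI[of _ h]) simp_all
    qed
  qed (use assms(2) nf p c in auto)
  show False using False_if_order_lt_200 AB assms(4) by blast
qed

end
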